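(* Let $m\ge1$ and let $\nabla$ be a statistical connection on the Takano Gaussian space $(\mathcal N_T^m,g^F)$. Then the following three conditions are equivalent: (i) $\nabla$ is $\mathrm{Aff}^{d+}(m,\mathbb{R})$-invariant and $(g^F,\nabla)$ is conjugate symmetric. (ii) $\nabla$ is $\mathrm{Aff}^{d+}(m,\mathbb{R})$-invariant and $(g^F,\nabla)$ has constant curvature. (iii) $\nabla=\nabla^{A(\alpha)}$ for some $\alpha\in\mathbb{R}$.
   Context: A statistical structure on a manifold $M$ is a pair $(g,\nabla)$ of a Riemannian metric $g$ and a torsion-free affine connection $\nabla$ such that $(X,Y,Z)\mapsto(\nabla_X g)(Y,Z)$ is totally symmetric; then $\nabla$ is called a statistical connection on $(M,g)$. For fixed $g$, $\nabla\mapsto\nabla g$ is a bijection from statistical connections onto symmetric $(0,3)$-tensor fields. The dual connection $\overline\nabla$ is defined by $Xg(Y,Z)=g(\nabla_XY,Z)+g(Y,\overline\nabla_XZ)$. $(g,\nabla)$ is conjugate symmetric if the curvature tensors satisfy $R^\nabla=R^{\overline\nabla}$; it has constant curvature if there is a constant $k\in\mathbb{R}$ with $R^\nabla(X,Y)Z=k(g(Y,Z)X-g(X,Z)Y)$ for all $X,Y,Z$. Let $\mathcal N_T^m=\mathbb{R}_{>0}\times\mathbb{R}^m$, and for $(\Sigma,\mu)\in\mathcal N_T^m$ let $N(x\mid\Sigma,\mu)=(2\pi\Sigma)^{-m/2}\exp(-\frac1{2\Sigma}|x-\mu|^2)$, $x\in\mathbb{R}^m$ (the normal density with mean $\mu$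 and covariance $\Sigma I_m$). The Fisher metric is $g^F_{\hat\theta}(X,Y)=\int_{\mathbb{R}^m}(X\log N(x\mid\theta))(Y\log N(x\mid\theta))N(x\mid\hat\theta)\,dx$ and the Amari--Chentsov $\alpha$-tensor field is $C^{A(\alpha)}_{\hat\theta}(X,Y,Z)=\alpha\int_{\mathbb{R}^m}(X\log N(x\mid\theta))(Y\log N(x\mid\theta))(Z\log N(x\mid\theta))N(x\mid\hat\theta)\,dx$, for $\hat\theta\in\mathcal N_T^m$ and $X,Y,Z\in T_{\hat\theta}\mathcal N_T^m$. The Amari--Chentsov $\alpha$-connection $\nabla^{A(\alpha)}$ is the statistical connection on $(\mathcal N_T^m,g^F)$ with $\nabla^{A(\alpha)}g^F=C^{A(\alpha)}$. $(\mathcal N_T^m,g^F)$ is called the Takano Gaussian space. The group $\mathrm{Aff}^{d+}(m,\mathbb{R})=\mathbb{R}_{>0}\ltimes\mathbb{R}^m$ (maps $x\mapsto ax+b$, $a>0$, $b\in\mathbb{R}^m$) acts simply-transitively on $\mathcal N_T^m$ by push-forward of measures, i.e. $(a,b).(\Sigma,\mu)=(a^2\Sigma,a\mu+b)$. *)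

theory Defs
  imports "HOL-Analysis.Analysis"
begin

section \<open>Geometry of open subsets of a Euclidean space\<close>

text \<open>
  The manifolds are open subsets \<open>M\<close> of a Euclidean space \<open>'a\<close>, with every tangent space
  identified with \<open>'a\<close>. A vector field on \<open>M\<close> is a function on all of \<open>'a\<close> whose values outside
  \<open>M\<close> are irrelevant; equations between fields are only ever required at points of \<open>M\<close>.
\<close>

type_synonym 'a field = "'a \<Rightarrow> 'a"
type_synonym 'a connection = "'a field \<Rightarrow> 'a field \<Rightarrow> 'a field"
type_synonym 'a form2 = "'a \<Rightarrow> 'a \<Rightarrow> 'a \<Rightarrow> real"

text \<open>For open \<open>S\<close> in a Euclidean space this is \<open>C^k\<close>: all directional derivatives are \<open>C^(k-1)\<close>.\<close>

primrec Ck_on :: "nat \<Rightarrow> 'a::euclidean_space set \<Rightarrow> ('a \<Rightarrow> 'b::real_normed_vector) \<Rightarrow> bool" where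
  "Ck_on 0 S f \<longleftrightarrow> continuous_on S f"
| "Ck_on (Suc k) S f \<longleftrightarrow>
     (\<forall>x\<in>S. f differentiable (at x)) \<and>
     (\<forall>v. Ck_on k S (\<lambda>x. frechet_derivative f (at x) v))"

definition smooth_on :: "'a::euclidean_space set \<Rightarrow> ('a \<Rightarrow> 'b::real_normed_vector) \<Rightarrow> bool" where
  "smooth_on S f \<longleftrightarrow> (\<forall>k. Ck_on k S f)"

definition vector_fields :: "'a::euclidean_space set \<Rightarrow> 'a field set" where
  "vector_fields M = {X. smooth_on M X}"

text \<open>The derivative of \<open>f\<close> along \<open>X\<close>, that is \<open>X f\<close>.\<close>

definition along :: "'a field \<Rightarrow> ('a \<Rightarrow> 'b) \<Rightarrow> 'a::euclidean_space \<Rightarrow> 'b::real_normed_vector" where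
  "along X f p = frechet_derivative f (at p) (X p)"

definition lie_bracket :: "'a field \<Rightarrow> 'a field \<Rightarrow> 'a::euclidean_space field" where
  "lie_bracket X Y p = along X Y p - along Y X p"

definition riemannian_metric :: "'a::euclidean_space set \<Rightarrow> 'a form2 \<Rightarrow> bool" where
  "riemannian_metric M g \<longleftrightarrow>
     (\<forall>p\<in>M. bilinear (g p) \<and> (\<forall>u v. g p u v = g p v u) \<and> (\<forall>v. v \<noteq> 0 \<longrightarrow> g p v v > 0)) \<and>
     (\<forall>u v. smooth_on M (\<lambda>p. g p u v))"

text \<open>
  Tensoriality in the first argument and the Leibniz rule in the second, applied with functions
  \<open>f\<close> that vanish on \<open>M\<close>, force \<open>D X Y\<close> on \<open>M\<close> to depend only on the restrictions of \<open>X\<close> and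
  \<open>Y\<close> to \<open>M\<close>.
\<close>

definition affine_connection :: "'a::euclidean_space set \<Rightarrow> 'a connection \<Rightarrow> bool" where
  "affine_connection M D \<longleftrightarrow>
     (\<forall>X\<in>vector_fields M. \<forall>Y\<in>vector_fields M. D X Y \<in> vector_fields M) \<and>
     (\<forall>X\<in>vector_fields M. \<forall>X'\<in>vector_fields M. \<forall>Y\<in>vector_fields M. \<forall>p\<in>M.
        D (\<lambda>q. X q + X' q) Y p = D X Y p + D X' Y p) \<and>
     (\<forall>f::'a \<Rightarrow> real. smooth_on M f \<longrightarrow>
       (\<forall>X\<in>vector_fields M. \<forall>Y\<in>vector_fields M. \<forall>p\<in>M.
          D (\<lambda>q. f q *\<^sub>R X q) Y p = f p *\<^sub>R D X Y p)) \<and>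
     (\<forall>X\<in>vector_fields M. \<forall>Y\<in>vector_fields M. \<forall>Y'\<in>vector_fields M. \<forall>p\<in>M.
        D X (\<lambda>q. Y q + Y' q) p = D X Y p + D X Y' p) \<and>
     (\<forall>f::'a \<Rightarrow> real. smooth_on M f \<longrightarrow>
       (\<forall>X\<in>vector_fields M. \<forall>Y\<in>vector_fields M. \<forall>p\<in>M.
          D X (\<lambda>q. f q *\<^sub>R Y q) p = along X f p *\<^sub>R Y p + f p *\<^sub>R D X Y p))"

definition torsion_free :: "'a::euclidean_space set \<Rightarrow> 'a connection \<Rightarrow> bool" where
  "torsion_free M D \<longleftrightarrow>
     (\<forall>X\<in>vector_fields M. \<forall>Y\<in>vector_fields M. \<forall>p\<in>M.
        D X Y p - D Y X p = lie_bracket X Y p)"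

definition covariant_derivative_metric ::
    "'a form2 \<Rightarrow> 'a connection \<Rightarrow> 'a field \<Rightarrow> 'a field \<Rightarrow> 'a field \<Rightarrow> 'a::euclidean_space \<Rightarrow> real" where
  "covariant_derivative_metric g D X Y Z p =
     along X (\<lambda>q. g q (Y q) (Z q)) p - g p (D X Y p) (Z p) - g p (Y p) (D X Z p)"

definition statistical_structure ::
    "'a::euclidean_space set \<Rightarrow> 'a form2 \<Rightarrow> 'a connection \<Rightarrow> bool" where
  "statistical_structure M g D \<longleftrightarrow>
     riemannian_metric M g \<and> affine_connection M D \<and> torsion_free M D \<and>
     (\<forall>X\<in>vector_fields M. \<forall>Y\<in>vector_fields M. \<forall>Z\<in>vector_fields M. \<forall>p\<in>M.
        covariant_derivative_metric g D X Y Z p = covariant_derivative_metric g D Y X Z p \<and>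
        covariant_derivative_metric g D X Y Z p = covariant_derivative_metric g D X Z Y p)"

text \<open>
  Stated as a relation: the dual \<open>D'\<close> of \<open>D\<close> is determined only on vector fields on \<open>M\<close> and at
  points of \<open>M\<close>.
\<close>

definition dual_connection ::
    "'a::euclidean_space set \<Rightarrow> 'a form2 \<Rightarrow> 'a connection \<Rightarrow> 'a connection \<Rightarrow> bool" where
  "dual_connection M g D D' \<longleftrightarrow>
     affine_connection M D' \<and>
     (\<forall>X\<in>vector_fields M. \<forall>Y\<in>vector_fields M. \<forall>Z\<in>vector_fields M. \<forall>p\<in>M.
        along X (\<lambda>q. g q (Y q) (Z q)) p = g p (D X Y p) (Z p) + g p (Y p) (D' X Z p))"

definition curvature ::
    "'a connection \<Rightarrow> 'a field \<Rightarrow> 'a field \<Rightarrow> 'a field \<Rightarrow> 'a::euclidean_space field" where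
  "curvature D X Y Z p = D X (D Y Z) p - D Y (D X Z) p - D (lie_bracket X Y) Z p"

definition conjugate_symmetric ::
    "'a::euclidean_space set \<Rightarrow> 'a form2 \<Rightarrow> 'a connection \<Rightarrow> bool" where
  "conjugate_symmetric M g D \<longleftrightarrow>
     (\<exists>D'. dual_connection M g D D' \<and>
       (\<forall>X\<in>vector_fields M. \<forall>Y\<in>vector_fields M. \<forall>Z\<in>vector_fields M. \<forall>p\<in>M.
          curvature D X Y Z p = curvature D' X Y Z p))"

definition constant_curvature ::
    "'a::euclidean_space set \<Rightarrow> 'a form2 \<Rightarrow> 'a connection \<Rightarrow> bool" where
  "constant_curvature M g D \<longleftrightarrow>
     (\<exists>k::real. \<forall>X\<in>vector_fields M. \<forall>Y\<in>vector_fields M. \<forall>Z\<in>vector_fields M. \<forall>p\<in>M.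
        curvature D X Y Z p = k *\<^sub>R (g p (Y p) (Z p) *\<^sub>R X p - g p (X p) (Z p) *\<^sub>R Y p))"

definition pushforward :: "'a::euclidean_space set \<Rightarrow> ('a \<Rightarrow> 'a) \<Rightarrow> 'a field \<Rightarrow> 'a field" where
  "pushforward M \<phi> X q =
     frechet_derivative \<phi> (at (inv_into M \<phi> q)) (X (inv_into M \<phi> q))"

text \<open>\<open>\<Phi>\<close> is the set of diffeomorphisms of \<open>M\<close> by which the group acts.\<close>

definition invariant_connection ::
    "'a::euclidean_space set \<Rightarrow> ('a \<Rightarrow> 'a) set \<Rightarrow> 'a connection \<Rightarrow> bool" where
  "invariant_connection M \<Phi> D \<longleftrightarrow>
     (\<forall>\<phi>\<in>\<Phi>. \<forall>X\<in>vector_fields M. \<forall>Y\<in>vector_fields M. \<forall>q\<in>M.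
        D (pushforward M \<phi> X) (pushforward M \<phi> Y) q = pushforward M \<phi> (D X Y) q)"

section \<open>The Takano Gaussian space\<close>

text \<open>A point is a pair \<open>(\<Sigma>, \<mu>)\<close> of variance and mean; \<open>m = CARD('m)\<close>.\<close>

definition takano_space :: "(real \<times> (real^'m)) set" where
  "takano_space = {\<theta>. fst \<theta> > 0}"

definition gaussian :: "real \<times> (real^'m) \<Rightarrow> real^'m \<Rightarrow> real" where
  "gaussian \<theta> x =
     (2 * pi * fst \<theta>) powr (- real CARD('m) / 2) *
     exp (- (norm (x - snd \<theta>))\<^sup>2 / (2 * fst \<theta>))"

text \<open>\<open>X log N(x | \<theta>)\<close> for the tangent vector \<open>v = X\<close> at \<open>p\<close>.\<close>

definition score :: "real \<times> (real^'m) \<Rightarrow> real \<times> (real^'m) \<Rightarrow> real^'m \<Rightarrow> real" where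
  "score p v x = frechet_derivative (\<lambda>\<theta>. ln (gaussian \<theta> x)) (at p) v"

definition fisher_metric :: "(real \<times> (real^'m)) form2" where
  "fisher_metric p u v = (LINT x|lborel. score p u x * score p v x * gaussian p x)"

definition amari_chentsov_tensor ::
    "real \<Rightarrow> real \<times> (real^'m) \<Rightarrow> real \<times> (real^'m) \<Rightarrow> real \<times> (real^'m) \<Rightarrow> real \<times> (real^'m) \<Rightarrow> real" where
  "amari_chentsov_tensor \<alpha> p u v w =
     \<alpha> * (LINT x|lborel. score p u x * score p v x * score p w x * gaussian p x)"

text \<open>
  As with duals, a relation: a statistical connection is determined by its cubic form on vector
  fields on \<open>takano_space\<close> and at points of \<open>takano_space\<close>, hence up to irrelevant values.
\<close>

definition amari_chentsov_connection :: "real \<Rightarrow> (real \<times> (real^'m)) connection \<Rightarrow> bool" where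
  "amari_chentsov_connection \<alpha> D \<longleftrightarrow>
     statistical_structure takano_space fisher_metric D \<and>
     (\<forall>X\<in>vector_fields takano_space. \<forall>Y\<in>vector_fields takano_space.
      \<forall>Z\<in>vector_fields takano_space. \<forall>p\<in>takano_space.
        covariant_derivative_metric fisher_metric D X Y Z p =
        amari_chentsov_tensor \<alpha> p (X p) (Y p) (Z p))"

text \<open>
  The push-forward of the normal distribution at \<open>(\<Sigma>, \<mu>)\<close> under \<open>x \<mapsto> a x + b\<close> is the one at
  \<open>(a\<^sup>2 \<Sigma>, a \<mu> + b)\<close>.
\<close>

definition affine_action :: "real \<Rightarrow> real^'m \<Rightarrow> real \<times> (real^'m) \<Rightarrow> real \<times> (real^'m)" where
  "affine_action a b \<theta> = (a\<^sup>2 * fst \<theta>, a *\<^sub>R snd \<theta> + b)"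

definition Aff_dplus :: "(real \<times> (real^'m) \<Rightarrow> real \<times> (real^'m)) set" where
  "Aff_dplus = {affine_action a b | a b. a > 0}"

end

theory Submission
  imports Defs "HOL-Probability.Distributions"
begin

text \<open>
  The group acts simply transitively, so an invariant connection has constant coefficients in the
  frame of invariant vector fields, where the metric is constant too. There everything becomes algebra on
  \<open>\<real> \<times> \<real>\<^sup>m\<close>: the connection is a bilinear product \<open>B = L + K\<close>, where \<open>L\<close> is the product of the
  Levi-Civita connection, and \<open>K\<close> corresponds to a symmetric trilinear form \<open>S\<close> with \<open>\<nabla> g = - 2 S\<close>.

  Conjugate symmetry and constant curvature have a common consequence, namely that each operator
  \<open>R(X, Y)\<close> is skew-adjoint. For constant curvature this is immediate from the formula; for conjugate
  symmetry it holds because the curvature of the dual connection is the negative adjoint of \<open>R\<close>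
  (\<open>conjugate_symmetric_imp_skew\<close>). The symmetric part of \<open>R\<close> is the antisymmetrized Levi-Civita
  derivative of \<open>K\<close>, and its vanishing in the plane of the variance direction and a mean direction already
  leaves \<open>S\<close> a single free parameter (\<open>skew_curvature_cubic_form\<close>). The moments of the score show
  that the Amari-Chentsov tensor is the form so obtained (\<open>amari_chentsov_tensor_eq\<close>).

  Conversely, the Koszul formula yields the Christoffel symbols of \<open>\<nabla>\<^sup>A\<^sup>(\<^sup>\<alpha>\<^sup>)\<close>. They are equivariant, and
  \<open>\<nabla>\<^sup>A\<^sup>(\<^sup>\<alpha>\<^sup>)\<close> has constant curvature \<open>- (1 - \<alpha>\<^sup>2) / (2 m)\<close>; its dual is \<open>\<nabla>\<^sup>A\<^sup>(\<^sup>-\<^sup>\<alpha>\<^sup>)\<close>, and the curvature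
  is even in \<open>\<alpha>\<close>, whence conjugate symmetry.

  Passing between connections, which act on smooth fields, and pointwise algebra takes
  three general facts: a connection is determined by its Christoffel symbols, its curvature is
  tensorial, and the cubic form is tensorial. The tensoriality of curvature rests on the symmetry of second derivatives.
\<close>

section \<open>Smooth maps on open sets\<close>

lemma Ck_on_Suc_imp_Ck_on: "Ck_on (Suc k) S f \<Longrightarrow> Ck_on k S f"
proof (induction k arbitrary: f)
  case 0
  have "continuous (at x within S) f" if "x \<in> S" for x
    using 0 that by (auto intro: differentiable_imp_continuous_within continuous_at_imp_continuous_at_within)
  then show ?case by (simp add: continuous_on_eq_continuous_within)
next
  case (Suc k)
  then show ?case by (metis Ck_on.simps(2))
qed

lemma Ck_on_cong:
  assumes "open S" "\<And>x. x \<in> S \<Longrightarrow> f x = g x"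
  shows "Ck_on k S f \<longleftrightarrow> Ck_on k S g"
proof -
  have "Ck_on k S g" if "Ck_on k S f" "\<And>x. x \<in> S \<Longrightarrow> f x = g x" for f g
    using that
  proof (induction k arbitrary: f g)
    case 0
    then show ?case by (metis Ck_on.simps(1) continuous_on_cong)
  next
    case (Suc k)
    have diff: "g differentiable (at x)" if "x \<in> S" for x
      using Suc.prems that \<open>open S\<close>
      by (metis Ck_on.simps(2) differentiable_def has_derivative_transform_within_open)
    have "frechet_derivative f (at x) v = frechet_derivative g (at x) v" if "x \<in> S" for x v
      using Suc.prems that \<open>open S\<close> 
      by (metis Ck_on.simps(2) frechet_derivative_transform_within_open)
    then have "Ck_on k S (\<lambda>x. frechet_derivative g (at x) v)" for v
      using Suc.IH[of "\<lambda>x. frechet_derivative f (at x) v"] Suc.prems by auto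
    then show ?case using diff by simp
  qed
  then show ?thesis using assms(2) by metis
qed

lemma Ck_on_SucI:
  assumes "open S" "\<And>x. x \<in> S \<Longrightarrow> (f has_derivative f' x) (at x)"
    and "\<And>v. Ck_on k S (\<lambda>x. f' x v)"
  shows "Ck_on (Suc k) S f"
proof -
  have "Ck_on k S (\<lambda>x. frechet_derivative f (at x) v)" for v
    using assms(3)[of v] Ck_on_cong[OF assms(1), of "\<lambda>x. f' x v" "\<lambda>x. frechet_derivative f (at x) v"]
      frechet_derivative_at[OF assms(2)] by metis
  then show ?thesis using assms(2) by (auto simp: differentiable_def)
qed

lemma Ck_on_SucD:
  assumes "Ck_on (Suc k) S f"
  shows "x \<in> S \<Longrightarrow> (f has_derivative frechet_derivative f (at x)) (at x)"
    and "Ck_on k S (\<lambda>x. frechet_derivative f (at x) v)"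
  using assms frechet_derivative_works by auto

lemma Ck_on_const: "Ck_on k S (\<lambda>x. c)"
  by (induction k arbitrary: c) auto

lemma Ck_on_add:
  assumes "open S"
  shows "Ck_on k S f \<Longrightarrow> Ck_on k S g \<Longrightarrow> Ck_on k S (\<lambda>x. f x + g x)"
proof (induction k arbitrary: f g)
  case 0 then show ?case by (auto intro: continuous_intros)
next
  case (Suc k)
  show ?case
    by (rule Ck_on_SucI[OF assms has_derivative_add[OF Ck_on_SucD(1)[OF Suc.prems(1)]
            Ck_on_SucD(1)[OF Suc.prems(2)]]])
      (use Suc.IH[OF Ck_on_SucD(2)[OF Suc.prems(1)] Ck_on_SucD(2)[OF Suc.prems(2)]] in auto)
qed

lemma Ck_on_bounded_linear:
  assumes "open S" "bounded_linear h"
  shows "Ck_on k S f \<Longrightarrow> Ck_on k S (\<lambda>x. h (f x))"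
proof (induction k arbitrary: f)
  case 0
  then show ?case using bounded_linear.continuous_on[OF assms(2)] by simp
next
  case (Suc k)
  show ?case
    by (rule Ck_on_SucI[OF assms(1) bounded_linear.has_derivative[OF assms(2)
            Ck_on_SucD(1)[OF Suc.prems]]])
      (use Suc.IH[OF Ck_on_SucD(2)[OF Suc.prems]] in auto)
qed

lemma Ck_on_scaleR:
  fixes f :: "'a::euclidean_space \<Rightarrow> real"
  assumes "open S"
  shows "Ck_on k S f \<Longrightarrow> Ck_on k S g \<Longrightarrow> Ck_on k S (\<lambda>x. f x *\<^sub>R g x)"
proof (induction k arbitrary: f g)
  case 0 then show ?case by (auto intro: continuous_intros)
next
  case (Suc k)
  show ?case
    by (rule Ck_on_SucI[OF assms has_derivative_scaleR[OF Ck_on_SucD(1)[OF Suc.prems(1)]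
            Ck_on_SucD(1)[OF Suc.prems(2)]]], assumption, assumption)
      (intro Ck_on_add[OF assms] Suc.IH Ck_on_SucD(2)[OF Suc.prems(1)] 
        Ck_on_SucD(2)[OF Suc.prems(2)] Ck_on_Suc_imp_Ck_on[OF Suc.prems(1)] 
        Ck_on_Suc_imp_Ck_on[OF Suc.prems(2)])
qed

text \<open>Precomposition with an affine map only replaces the direction of each derivative by its
  image under the linear part, which is what the induction over the order uses.\<close>

lemma Ck_on_compose_affine:
  assumes "open S" "bounded_linear L" "\<And>x. x \<in> S \<Longrightarrow> L x + c \<in> T"
  shows "Ck_on k T f \<Longrightarrow> Ck_on k S (\<lambda>x. f (L x + c))"
proof (induction k arbitrary: f)
  case 0
  have "continuous_on S (\<lambda>x. L x + c)"
    using bounded_linear.continuous_on[OF assms(2) continuous_on_id] by (intro continuous_intros)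
  then show ?case using 0 assms(3) by (auto intro!: continuous_on_compose2[of T f])
next
  case (Suc k)
  have "((\<lambda>x. f (L x + c)) has_derivative (\<lambda>v. frechet_derivative f (at (L x + c)) (L v))) (at x)"
    if "x \<in> S" for x
  proof -
    have "((\<lambda>x. L x + c) has_derivative L) (at x)"
      using has_derivative_add_const[OF bounded_linear_imp_has_derivative[OF assms(2)]] by simp
    then show ?thesis
      using diff_chain_at[of "\<lambda>x. L x + c" L x f] Ck_on_SucD(1)[OF Suc.prems assms(3)[OF that]]
      by (simp add: o_def)
  qed
  then show ?case
    by (rule Ck_on_SucI[OF assms(1)]) (use Suc.IH[OF Ck_on_SucD(2)[OF Suc.prems]] in auto)
qed

lemma smooth_on_const: "smooth_on S (\<lambda>x. c)"
  by (simp add: smooth_on_def Ck_on_const)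

lemma smooth_on_add: "open S \<Longrightarrow> smooth_on S f \<Longrightarrow> smooth_on S g \<Longrightarrow> smooth_on S (\<lambda>x. f x + g x)"
  by (simp add: smooth_on_def Ck_on_add)

lemma smooth_on_scaleR:
  fixes f :: "'a::euclidean_space \<Rightarrow> real"
  shows "open S \<Longrightarrow> smooth_on S f \<Longrightarrow> smooth_on S g \<Longrightarrow> smooth_on S (\<lambda>x. f x *\<^sub>R g x)"
  by (simp add: smooth_on_def Ck_on_scaleR)

lemma smooth_on_bounded_linear:
  "open S \<Longrightarrow> bounded_linear h \<Longrightarrow> smooth_on S f \<Longrightarrow> smooth_on S (\<lambda>x. h (f x))"
  by (simp add: smooth_on_def Ck_on_bounded_linear)

lemma smooth_on_compose_affine:
  "open S \<Longrightarrow> bounded_linear L \<Longrightarrow> (\<And>x. x \<in> S \<Longrightarrow> L x + c \<in> T) \<Longrightarrow> smooth_on T f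
   \<Longrightarrow> smooth_on S (\<lambda>x. f (L x + c))"
  unfolding smooth_on_def using Ck_on_compose_affine by blast

lemma smooth_on_cong:
  "open S \<Longrightarrow> (\<And>x. x \<in> S \<Longrightarrow> f x = g x) \<Longrightarrow> smooth_on S f \<longleftrightarrow> smooth_on S g"
  unfolding smooth_on_def using Ck_on_cong by metis

lemma smooth_on_minus: 
  assumes "open S" "smooth_on S f" "smooth_on S g" 
  shows "smooth_on S (\<lambda>x. f x - g x)"
  using smooth_on_add[OF assms(1,2) smooth_on_scaleR[OF assms(1) smooth_on_const[of _ "-1::real"] assms(3)]]
  by simp

lemma smooth_on_sum:
  "open S \<Longrightarrow> (\<And>i. i \<in> I \<Longrightarrow> smooth_on S (f i)) \<Longrightarrow> smooth_on S (\<lambda>x. \<Sum>i\<in>I. f i x)"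
  by (induction I rule: infinite_finite_induct) (auto intro: smooth_on_const smooth_on_add)

lemma smooth_on_has_derivative:
  "smooth_on S f \<Longrightarrow> x \<in> S \<Longrightarrow> (f has_derivative frechet_derivative f (at x)) (at x)"
  using Ck_on_SucD(1) unfolding smooth_on_def by blast

lemma smooth_on_differentiable:
  "smooth_on S f \<Longrightarrow> x \<in> S \<Longrightarrow> f differentiable (at x)"
  by (metis smooth_on_has_derivative differentiable_def)

lemma smooth_on_frechet_derivative:
  "smooth_on S f \<Longrightarrow> smooth_on S (\<lambda>x. frechet_derivative f (at x) v)"
  using Ck_on_SucD(2) unfolding smooth_on_def by blast

lemma frechet_derivative_cong_open:
  assumes "open S" "x \<in> S" "\<And>y. y \<in> S \<Longrightarrow> f y = g y"
  shows "frechet_derivative f (at x) = frechet_derivative g (at x)"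
proof -
  have "(f has_derivative f') (at x) \<longleftrightarrow> (g has_derivative f') (at x)" for f'
    using has_derivative_transform_within_open[OF _ assms(1,2)] assms(3) by metis
  then show ?thesis unfolding frechet_derivative_def by simp
qed

lemma frechet_derivative_linear:
  "smooth_on S f \<Longrightarrow> x \<in> S \<Longrightarrow> linear (frechet_derivative f (at x))"
  using smooth_on_differentiable linear_frechet_derivative by blast

lemma linear_field_expand:
  fixes T :: "'a \<Rightarrow> 'b::euclidean_space \<Rightarrow> 'c::real_normed_vector"
  assumes "linear (T q)"
  shows "T q y = (\<Sum>b\<in>Basis. (y \<bullet> b) *\<^sub>R T q b)"
proof -
  have "T q (\<Sum>b\<in>Basis. (y \<bullet> b) *\<^sub>R b) = (\<Sum>b\<in>Basis. (y \<bullet> b) *\<^sub>R T q b)"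
    by (simp add: linear_sum[OF assms] linear_scale[OF assms])
  then show ?thesis by (simp add: euclidean_representation)
qed

text \<open>A smooth family of linear maps may be fed with a smooth field: expanding the argument in a basis
  reduces this to the product rule. It serves for derivatives, metrics and Christoffel symbols.\<close>

lemma linear_field_apply:
  fixes T :: "'a::euclidean_space \<Rightarrow> 'b::euclidean_space \<Rightarrow> 'c::real_normed_vector"
  assumes "open M" and lin: "\<And>q. q \<in> M \<Longrightarrow> linear (T q)"
    and sm: "\<And>v. smooth_on M (\<lambda>q. T q v)" and Y: "smooth_on M Y"
  shows smooth_on_linear_field_apply: "smooth_on M (\<lambda>q. T q (Y q))"
    and has_derivative_linear_field_apply:
      "p \<in> M \<Longrightarrow> ((\<lambda>q. T q (Y q)) has_derivative (\<lambda>h.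
         frechet_derivative (\<lambda>q. T q (Y p)) (at p) h + T p (frechet_derivative Y (at p) h))) (at p)"
proof -
  have eq: "T q y = (\<Sum>b\<in>Basis. (y \<bullet> b) *\<^sub>R T q b)" if "q \<in> M" for q y
    using linear_field_expand[of T q y] lin[OF that] by blast
  have sYb: "smooth_on M (\<lambda>q. Y q \<bullet> b)" for b
    by (rule smooth_on_bounded_linear[OF assms(1) bounded_linear_inner_left Y])
  have "smooth_on M (\<lambda>q. \<Sum>b\<in>Basis. (Y q \<bullet> b) *\<^sub>R T q b)"
    by (intro smooth_on_sum smooth_on_scaleR assms(1) sYb sm)
  then show "smooth_on M (\<lambda>q. T q (Y q))"
    using smooth_on_cong[OF assms(1), of "\<lambda>q. T q (Y q)" "\<lambda>q. \<Sum>b\<in>Basis. (Y q \<bullet> b) *\<^sub>R T q b"] eq by simp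
  assume p: "p \<in> M"
  have dT: "((\<lambda>q. T q v) has_derivative frechet_derivative (\<lambda>q. T q v) (at p)) (at p)" for v
    by (rule smooth_on_has_derivative[OF sm p])
  have dc: "((\<lambda>q. T q y) has_derivative (\<lambda>h. \<Sum>b\<in>Basis. (y \<bullet> b) *\<^sub>R frechet_derivative (\<lambda>q. T q b) (at p) h)) (at p)" for y
  proof (rule has_derivative_transform_within_open[OF _ assms(1) p eq[symmetric]])
    show "((\<lambda>q. \<Sum>b\<in>Basis. (y \<bullet> b) *\<^sub>R T q b) has_derivative (\<lambda>h. \<Sum>b\<in>Basis. (y \<bullet> b) *\<^sub>R frechet_derivative (\<lambda>q. T q b) (at p) h)) (at p)"
      by (intro has_derivative_sum has_derivative_scaleR_right dT)
  qed
  have dYb: "((\<lambda>q. Y q \<bullet> b) has_derivative (\<lambda>h. frechet_derivative Y (at p) h \<bullet> b)) (at p)" for b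
    by (rule has_derivative_inner_left[OF smooth_on_has_derivative[OF Y p]])
  have d: "((\<lambda>q. \<Sum>b\<in>Basis. (Y q \<bullet> b) *\<^sub>R T q b) has_derivative (\<lambda>h. \<Sum>b\<in>Basis.
      (Y p \<bullet> b) *\<^sub>R frechet_derivative (\<lambda>q. T q b) (at p) h
      + (frechet_derivative Y (at p) h \<bullet> b) *\<^sub>R T p b)) (at p)"
    by (intro has_derivative_sum has_derivative_scaleR dT dYb)
  have "((\<lambda>q. T q (Y q)) has_derivative (\<lambda>h. \<Sum>b\<in>Basis.
      (Y p \<bullet> b) *\<^sub>R frechet_derivative (\<lambda>q. T q b) (at p) h
      + (frechet_derivative Y (at p) h \<bullet> b) *\<^sub>R T p b)) (at p)"
    by (rule has_derivative_transform_within_open[OF d assms(1) p eq[symmetric]])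
  moreover have "frechet_derivative (\<lambda>q. T q (Y p)) (at p) = (\<lambda>h. \<Sum>b\<in>Basis. (Y p \<bullet> b) *\<^sub>R frechet_derivative (\<lambda>q. T q b) (at p) h)"
    by (rule frechet_derivative_at[OF dc, symmetric])
  ultimately show "((\<lambda>q. T q (Y q)) has_derivative (\<lambda>h.
         frechet_derivative (\<lambda>q. T q (Y p)) (at p) h + T p (frechet_derivative Y (at p) h))) (at p)"
    by (simp add: sum.distrib eq[OF p, of "frechet_derivative Y (at p) _"])
qed

text \<open>Symmetry of second derivatives: two applications of the mean value theorem express the second
  difference of \<open>f\<close> over a small parallelogram through either mixed derivative at nearby points.\<close>

lemma second_difference_mean_value:
  fixes f :: "'a::euclidean_space \<Rightarrow> real"
  assumes sm: "smooth_on (ball p r) f" and h: "0 < h" "h * (norm u + norm v) < r"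
  shows "\<exists>x\<in>cball p (h * (norm u + norm v)).
    f (p + h *\<^sub>R u + h *\<^sub>R v) - f (p + h *\<^sub>R u) - f (p + h *\<^sub>R v) + f p
      = h * h * frechet_derivative (\<lambda>y. frechet_derivative f (at y) u) (at x) v"
proof -
  have near: "p + (s * h) *\<^sub>R u + (t * h) *\<^sub>R v \<in> cball p (h * (norm u + norm v))"
    if "0 \<le> s" "s \<le> 1" "0 \<le> t" "t \<le> 1" for s t
  proof -
    have "norm ((s * h) *\<^sub>R u + (t * h) *\<^sub>R v) \<le> (s * h) * norm u + (t * h) * norm v"
      using norm_triangle_ineq[of "(s * h) *\<^sub>R u" "(t * h) *\<^sub>R v"] that h by simp
    also have "\<dots> \<le> (1 * h) * norm u + (1 * h) * norm v"
      using that h by (intro add_mono mult_right_mono) auto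
    finally show ?thesis by (simp add: dist_norm algebra_simps norm_minus_commute)
  qed
  then have inb: "p + (s * h) *\<^sub>R u + (t * h) *\<^sub>R v \<in> ball p r"
    if "0 \<le> s" "s \<le> 1" "0 \<le> t" "t \<le> 1" for s t
    using that h by fastforce
  have chain: "((\<lambda>s. F (a + (s * h) *\<^sub>R w)) has_real_derivative h * frechet_derivative F (at (a + (s * h) *\<^sub>R w)) w) (at s)"
    if "smooth_on (ball p r) F" "a + (s * h) *\<^sub>R w \<in> ball p r" for F :: "'a \<Rightarrow> real" and a w s
  proof -
    have "((\<lambda>s. a + (s * h) *\<^sub>R w) has_derivative (\<lambda>t. (t * h) *\<^sub>R w)) (at s)"
      by (auto intro!: derivative_eq_intros)
    then have "((\<lambda>s. F (a + (s * h) *\<^sub>R w)) has_derivative (\<lambda>t. frechet_derivative F (at (a + (s * h) *\<^sub>R w)) ((t * h) *\<^sub>R w))) (at s)"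
      using diff_chain_at[of "\<lambda>s. a + (s * h) *\<^sub>R w" _ s F] smooth_on_has_derivative[OF that]
      by (simp add: o_def)
    moreover have "frechet_derivative F (at (a + (s * h) *\<^sub>R w)) ((t * h) *\<^sub>R w)
        = h * frechet_derivative F (at (a + (s * h) *\<^sub>R w)) w * t" for t
      using linear_scale[OF frechet_derivative_linear[OF that], of "t * h" w] by simp
    ultimately show ?thesis by (simp add: has_field_derivative_def)
  qed
  define \<phi> where "\<phi> s = f ((p + h *\<^sub>R v) + (s * h) *\<^sub>R u) - f (p + (s * h) *\<^sub>R u)" for s
  let ?Du = "\<lambda>y. frechet_derivative f (at y) u"
  have d\<phi>: "(\<phi> has_real_derivative h * ?Du ((p + h *\<^sub>R v) + (s * h) *\<^sub>R u) - h * ?Du (p + (s * h) *\<^sub>R u)) (at s)"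
    if "0 \<le> s" "s \<le> 1" for s
    unfolding \<phi>_def
    by (intro DERIV_diff chain sm) (use inb[OF that, of 0] inb[OF that, of 1] in \<open>simp_all add: algebra_simps\<close>)
  obtain s where s: "0 < s" "s < 1"
    and 1: "\<phi> 1 - \<phi> 0 = h * ?Du ((p + h *\<^sub>R v) + (s * h) *\<^sub>R u) - h * ?Du (p + (s * h) *\<^sub>R u)"
    using MVT2[of 0 1 \<phi> "\<lambda>s. h * ?Du ((p + h *\<^sub>R v) + (s * h) *\<^sub>R u) - h * ?Du (p + (s * h) *\<^sub>R u)"] d\<phi> by auto
  have d\<psi>: "((\<lambda>t. ?Du ((p + (s * h) *\<^sub>R u) + (t * h) *\<^sub>R v)) has_real_derivative
      h * frechet_derivative ?Du (at ((p + (s * h) *\<^sub>R u) + (t * h) *\<^sub>R v)) v) (at t)" if "0 \<le> t" "t \<le> 1" for t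
    by (intro chain smooth_on_frechet_derivative sm) (use inb[of s t] s that in auto)
  obtain t where t: "0 < t" "t < 1"
    and 2: "?Du ((p + (s * h) *\<^sub>R u) + (1 * h) *\<^sub>R v) - ?Du ((p + (s * h) *\<^sub>R u) + (0 * h) *\<^sub>R v)
      = h * frechet_derivative ?Du (at ((p + (s * h) *\<^sub>R u) + (t * h) *\<^sub>R v)) v"
    using MVT2[of 0 1 "\<lambda>t. ?Du ((p + (s * h) *\<^sub>R u) + (t * h) *\<^sub>R v)"
        "\<lambda>t. h * frechet_derivative ?Du (at ((p + (s * h) *\<^sub>R u) + (t * h) *\<^sub>R v)) v"] d\<psi> by auto
  have "?Du ((p + h *\<^sub>R v) + (s * h) *\<^sub>R u) = ?Du ((p + (s * h) *\<^sub>R u) + (1 * h) *\<^sub>R v)"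
    by (simp add: algebra_simps)
  then have "\<phi> 1 - \<phi> 0 = h * h * frechet_derivative ?Du (at ((p + (s * h) *\<^sub>R u) + (t * h) *\<^sub>R v)) v"
    using 1 2 by (simp add: right_diff_distrib[symmetric])
  moreover have "\<phi> 1 - \<phi> 0 = f (p + h *\<^sub>R u + h *\<^sub>R v) - f (p + h *\<^sub>R u) - f (p + h *\<^sub>R v) + f p"
    by (simp add: \<phi>_def algebra_simps)
  ultimately show ?thesis using near[of s t] s t by (intro bexI[of _ "p + (s * h) *\<^sub>R u + (t * h) *\<^sub>R v"]) auto
qed

lemma second_derivative_symmetric_real:
  fixes f :: "'a::euclidean_space \<Rightarrow> real"
  assumes "open M" "smooth_on M f" "p \<in> M"
  shows "frechet_derivative (\<lambda>y. frechet_derivative f (at y) u) (at p) v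
       = frechet_derivative (\<lambda>y. frechet_derivative f (at y) v) (at p) u"
proof -
  obtain r where r: "r > 0" "ball p r \<subseteq> M" using assms by (meson openE)
  let ?L = "\<lambda>x. frechet_derivative (\<lambda>y. frechet_derivative f (at y) u) (at x) v"
  let ?R = "\<lambda>x. frechet_derivative (\<lambda>y. frechet_derivative f (at y) v) (at x) u"
  have smb: "smooth_on (ball p r) f"
  proof -
    have "Ck_on k S f" if "Ck_on k M f" "S \<subseteq> M" for k S and f :: "'a \<Rightarrow> real"
      using that by (induction k arbitrary: f) (auto intro: continuous_on_subset)
    then show ?thesis using assms(2) r unfolding smooth_on_def by blast
  qed
  \<comment> \<open>the summand 1 only serves to divide by a positive number; \<open>h n\<close> shrinks to zero and keeps the parallelograms in the ball\<close>
  define N where "N = norm u + norm v + 1"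
  have N: "N > 0" by (simp add: N_def add_nonneg_pos)
  define h where "h n = r / (2 * N) / real (Suc n)" for n
  have hpos: "h n > 0" for n using r N by (simp add: h_def)
  have hN: "h n * (norm u + norm v) < r" for n
  proof -
    have "h n * N \<le> r / 2"
      using r N by (simp add: h_def divide_simps)
    moreover have "h n * (norm u + norm v) \<le> h n * N" using hpos[of n] by (simp add: N_def)
    ultimately show ?thesis using r by linarith
  qed
  have "\<exists>x y. x \<in> cball p (h n * (norm u + norm v)) \<and> y \<in> cball p (h n * (norm u + norm v)) \<and> ?L x = ?R y" for n
  proof -
    obtain x where x: "x\<in>cball p (h n * (norm u + norm v))"
      "f (p + h n *\<^sub>R u + h n *\<^sub>R v) - f (p + h n *\<^sub>R u) - f (p + h n *\<^sub>R v) + f p = h n * h n * ?L x"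
      using second_difference_mean_value[OF smb hpos hN] by blast
    obtain y where y: "y\<in>cball p (h n * (norm v + norm u))"
      "f (p + h n *\<^sub>R v + h n *\<^sub>R u) - f (p + h n *\<^sub>R v) - f (p + h n *\<^sub>R u) + f p = h n * h n * ?R y"
      using second_difference_mean_value[OF smb hpos, of n v u] hN[of n] by (auto simp: add.commute)
    have "h n * h n * ?L x = h n * h n * ?R y" using x(2) y(2) by (simp add: algebra_simps)
    then show ?thesis using x(1) y(1) hpos[of n] by (metis add.commute mult_left_cancel less_irrefl mult_pos_pos)
  qed
  then obtain x y where xy: "\<And>n. x n \<in> cball p (h n * (norm u + norm v))" "\<And>n. y n \<in> cball p (h n * (norm u + norm v))"
    "\<And>n. ?L (x n) = ?R (y n)" by metis
  have "h \<longlonglongrightarrow> 0" unfolding h_def using LIMSEQ_Suc[OF lim_const_over_n[of "r / (2 * N)"]] by simp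
  then have h0: "(\<lambda>n. h n * (norm u + norm v)) \<longlonglongrightarrow> 0" by (rule tendsto_mult_left_zero)
  have lim: "z \<longlonglongrightarrow> p" if "\<And>n. z n \<in> cball p (h n * (norm u + norm v))" for z
    by (rule metric_tendsto_imp_tendsto[OF h0]) (use that hpos in \<open>auto simp: dist_commute dist_norm abs_mult less_imp_le intro!: always_eventually\<close>)
  have cont: "isCont (\<lambda>x. frechet_derivative (\<lambda>y. frechet_derivative f (at y) w) (at x) z) p" for w z
  proof -
    have "Ck_on 0 M (\<lambda>x. frechet_derivative (\<lambda>y. frechet_derivative f (at y) w) (at x) z)"
      using assms(2) smooth_on_frechet_derivative unfolding smooth_on_def by blast
    then show ?thesis using assms by (simp add: continuous_on_eq_continuous_at)
  qed
  have "(\<lambda>n. ?L (x n)) \<longlonglongrightarrow> ?L p"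
    by (rule isCont_tendsto_compose[OF cont lim[OF xy(1)]])
  moreover have "(\<lambda>n. ?R (y n)) \<longlonglongrightarrow> ?R p"
    by (rule isCont_tendsto_compose[OF cont lim[OF xy(2)]])
  ultimately show ?thesis using LIMSEQ_unique xy(3) by auto
qed

lemma second_derivative_symmetric:
  fixes f :: "'a::euclidean_space \<Rightarrow> 'b::euclidean_space"
  assumes "open M" "smooth_on M f" "p \<in> M"
  shows "frechet_derivative (\<lambda>y. frechet_derivative f (at y) u) (at p) v
       = frechet_derivative (\<lambda>y. frechet_derivative f (at y) v) (at p) u"
proof (rule euclidean_eqI)
  fix b :: 'b assume "b \<in> Basis"
  have 1: "frechet_derivative (\<lambda>y. F y \<bullet> b) (at y) w = frechet_derivative F (at y) w \<bullet> b"
    if "smooth_on M F" "y \<in> M" for F :: "'a \<Rightarrow> 'b" and y w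
    using frechet_derivative_at[OF has_derivative_inner_left[OF smooth_on_has_derivative[OF that], of b]] 
    by (simp add: fun_eq_iff)
  have 2: "frechet_derivative (\<lambda>y. frechet_derivative (\<lambda>y. f y \<bullet> b) (at y) u) (at p) v
    = frechet_derivative (\<lambda>y. frechet_derivative f (at y) u) (at p) v \<bullet> b" for u v
  proof -
    have "frechet_derivative (\<lambda>y. frechet_derivative (\<lambda>y. f y \<bullet> b) (at y) u) (at p) v
      = frechet_derivative (\<lambda>y. frechet_derivative f (at y) u \<bullet> b) (at p) v"
      using frechet_derivative_cong_open[OF assms(1,3) 1[OF assms(2)]] by simp
    also have "\<dots> = frechet_derivative (\<lambda>y. frechet_derivative f (at y) u) (at p) v \<bullet> b"
      by (rule 1[OF smooth_on_frechet_derivative[OF assms(2)] assms(3)])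
    finally show ?thesis .
  qed
  show "frechet_derivative (\<lambda>y. frechet_derivative f (at y) u) (at p) v \<bullet> b
       = frechet_derivative (\<lambda>y. frechet_derivative f (at y) v) (at p) u \<bullet> b"
    using second_derivative_symmetric_real[OF assms(1) smooth_on_bounded_linear[OF assms(1) bounded_linear_inner_left assms(2)] assms(3), of b u v] 2 
    by simp
qed

section \<open>Affine connections and Christoffel symbols\<close>

lemma
  fixes B :: "'a::euclidean_space \<Rightarrow> 'a \<Rightarrow> 'a \<Rightarrow> 'b::euclidean_space"
  assumes "open M" and bil: "\<And>q. q \<in> M \<Longrightarrow> bilinear (B q)"
    and sm: "\<And>u v. smooth_on M (\<lambda>q. B q u v)" and Y: "smooth_on M Y" and Z: "smooth_on M Z"
  shows smooth_on_bilinear_field_apply: "smooth_on M (\<lambda>q. B q (Y q) (Z q))"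
    and frechet_derivative_bilinear_field_apply:
      "p \<in> M \<Longrightarrow> frechet_derivative (\<lambda>q. B q (Y q) (Z q)) (at p) h =
         frechet_derivative (\<lambda>q. B q (Y p) (Z p)) (at p) h
         + B p (frechet_derivative Y (at p) h) (Z p) + B p (Y p) (frechet_derivative Z (at p) h)"
proof -
  have lin: "linear (B q v)" "linear (\<lambda>v. B q v z)" if "q \<in> M" for q v z
    using bil[OF that] by (simp_all add: bilinear_def)
  have 1: "smooth_on M (\<lambda>q. B q v (Z q))" for v
    by (rule smooth_on_linear_field_apply[OF assms(1) lin(1) sm Z])
  show "smooth_on M (\<lambda>q. B q (Y q) (Z q))"
    by (rule smooth_on_linear_field_apply[OF assms(1) lin(2) 1 Y])
  assume p: "p \<in> M"
  have "frechet_derivative (\<lambda>q. B q (Y q) (Z q)) (at p) h =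
      frechet_derivative (\<lambda>q. B q (Y p) (Z q)) (at p) h + B p (frechet_derivative Y (at p) h) (Z p)"
    by (rule fun_cong[OF frechet_derivative_at[OF has_derivative_linear_field_apply[where
              T = "\<lambda>q v. B q v (Z q)", OF assms(1) lin(2) 1 Y p]], symmetric])
  moreover have "frechet_derivative (\<lambda>q. B q (Y p) (Z q)) (at p) h =
      frechet_derivative (\<lambda>q. B q (Y p) (Z p)) (at p) h + B p (Y p) (frechet_derivative Z (at p) h)"
    by (rule fun_cong[OF frechet_derivative_at[OF has_derivative_linear_field_apply[where
              T = "\<lambda>q. B q (Y p)", OF assms(1) lin(1) sm Z p]], symmetric])
  ultimately show "frechet_derivative (\<lambda>q. B q (Y q) (Z q)) (at p) h =
         frechet_derivative (\<lambda>q. B q (Y p) (Z p)) (at p) h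
         + B p (frechet_derivative Y (at p) h) (Z p) + B p (Y p) (frechet_derivative Z (at p) h)"
    by simp
qed

lemma const_vector_field [simp]: "(\<lambda>_. u) \<in> vector_fields M"
  by (simp add: vector_fields_def smooth_on_const)

lemma along_const [simp]: "along X (\<lambda>_. c) p = 0"
  by (simp add: along_def)

lemma smooth_on_along:
  fixes f :: "'a::euclidean_space \<Rightarrow> 'b::euclidean_space"
  assumes "open M" "smooth_on M X" "smooth_on M f"
  shows "smooth_on M (along X f)"
  unfolding along_def
  by (rule smooth_on_linear_field_apply[OF assms(1) frechet_derivative_linear[OF assms(3)]
        smooth_on_frechet_derivative[OF assms(3)] assms(2)])

lemma smooth_on_lie_bracket:
  "open M \<Longrightarrow> smooth_on M X \<Longrightarrow> smooth_on M Y \<Longrightarrow> smooth_on M (lie_bracket X Y)"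
  using smooth_on_minus[OF _ smooth_on_along smooth_on_along, of M X Y Y X]
  by (simp add: lie_bracket_def[abs_def])

definition christoffel :: "'a::euclidean_space connection \<Rightarrow> 'a \<Rightarrow> 'a \<Rightarrow> 'a \<Rightarrow> 'a" where
  "christoffel D p u v = D (\<lambda>_. u) (\<lambda>_. v) p"

definition christoffel_connection :: "('a \<Rightarrow> 'a \<Rightarrow> 'a \<Rightarrow> 'a) \<Rightarrow> 'a::euclidean_space connection" where
  "christoffel_connection \<Gamma> X Y p = along X Y p + \<Gamma> p (X p) (Y p)"

context
  fixes M :: "'a::euclidean_space set" and D :: "'a connection"
  assumes openM: "open M" and aff: "affine_connection M D"
begin

lemma affine_connection_smooth:
  "X \<in> vector_fields M \<Longrightarrow> Y \<in> vector_fields M \<Longrightarrow> D X Y \<in> vector_fields M"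
  using aff unfolding affine_connection_def by blast

lemma affine_connection_add_scale:
  assumes "X \<in> vector_fields M" "Y \<in> vector_fields M" "p \<in> M"
  shows affine_connection_add_left:
      "X' \<in> vector_fields M \<Longrightarrow> D (\<lambda>q. X q + X' q) Y p = D X Y p + D X' Y p"
    and affine_connection_scale_left:
      "smooth_on M f \<Longrightarrow> D (\<lambda>q. f q *\<^sub>R X q) Y p = f p *\<^sub>R D X Y p"
    and affine_connection_add_right:
      "Y' \<in> vector_fields M \<Longrightarrow> D X (\<lambda>q. Y q + Y' q) p = D X Y p + D X Y' p"
    and affine_connection_leibniz:
      "smooth_on M f \<Longrightarrow> D X (\<lambda>q. f q *\<^sub>R Y q) p = along X f p *\<^sub>R Y p + f p *\<^sub>R D X Y p"
  using aff assms unfolding affine_connection_def by blast+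

lemma affine_connection_sum_left:
  assumes "Y \<in> vector_fields M" "p \<in> M" "finite I" "\<And>i. i \<in> I \<Longrightarrow> smooth_on M (f i)"
  shows "D (\<lambda>q. \<Sum>i\<in>I. f i q *\<^sub>R c i) Y p = (\<Sum>i\<in>I. f i p *\<^sub>R D (\<lambda>_. c i) Y p)"
  using assms(3,4)
proof (induction I)
  case empty
  show ?case
    using affine_connection_scale_left[OF const_vector_field assms(1,2) smooth_on_const, of 0 0] by simp
next
  case (insert i I)
  have s: "(\<lambda>q. f i q *\<^sub>R c i) \<in> vector_fields M" "(\<lambda>q. \<Sum>i\<in>I. f i q *\<^sub>R c i) \<in> vector_fields M"
    using insert.prems unfolding vector_fields_def
    by (auto intro!: smooth_on_sum smooth_on_scaleR openM smooth_on_const)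
  have "D (\<lambda>q. f i q *\<^sub>R c i + (\<Sum>i\<in>I. f i q *\<^sub>R c i)) Y p
      = D (\<lambda>q. f i q *\<^sub>R c i) Y p + D (\<lambda>q. \<Sum>i\<in>I. f i q *\<^sub>R c i) Y p"
    by (rule affine_connection_add_left[OF s(1) assms(1,2) s(2)])
  moreover have "D (\<lambda>q. f i q *\<^sub>R c i) Y p = f i p *\<^sub>R D (\<lambda>_. c i) Y p"
    using affine_connection_scale_left[OF const_vector_field assms(1,2) insert.prems, of i "c i"] by simp
  ultimately show ?case using insert by simp
qed

lemma affine_connection_sum_right:
  assumes "X \<in> vector_fields M" "p \<in> M" "finite I" "\<And>i. i \<in> I \<Longrightarrow> smooth_on M (f i)"
  shows "D X (\<lambda>q. \<Sum>i\<in>I. f i q *\<^sub>R c i) p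
       = (\<Sum>i\<in>I. along X (f i) p *\<^sub>R c i + f i p *\<^sub>R D X (\<lambda>_. c i) p)"
  using assms(3,4)
proof (induction I)
  case empty
  show ?case
    using affine_connection_leibniz[OF assms(1) const_vector_field assms(2) smooth_on_const, of 0 0] by simp
next
  case (insert i I)
  have s: "(\<lambda>q. f i q *\<^sub>R c i) \<in> vector_fields M" "(\<lambda>q. \<Sum>i\<in>I. f i q *\<^sub>R c i) \<in> vector_fields M"
    using insert.prems unfolding vector_fields_def
    by (auto intro!: smooth_on_sum smooth_on_scaleR openM smooth_on_const)
  have "D X (\<lambda>q. f i q *\<^sub>R c i + (\<Sum>i\<in>I. f i q *\<^sub>R c i)) p
      = D X (\<lambda>q. f i q *\<^sub>R c i) p + D X (\<lambda>q. \<Sum>i\<in>I. f i q *\<^sub>R c i) p"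
    by (rule affine_connection_add_right[OF assms(1) s(1) assms(2) s(2)])
  moreover have "D X (\<lambda>q. f i q *\<^sub>R c i) p = along X (f i) p *\<^sub>R c i + f i p *\<^sub>R D X (\<lambda>_. c i) p"
    using affine_connection_leibniz[OF assms(1) const_vector_field assms(2) insert.prems, of i "c i"] by simp
  ultimately show ?case using insert by simp
qed

lemma smooth_on_christoffel: "smooth_on M (\<lambda>p. christoffel D p u v)"
  using affine_connection_smooth[OF const_vector_field const_vector_field, of u v]
  by (simp add: christoffel_def vector_fields_def)

text \<open>Expanding both arguments in the standard basis with the Leibniz rule determines a connection
  by its values on constant fields. In particular it is a local operator.\<close>

lemma affine_connection_eq_christoffel_bilinear:
  assumes "p \<in> M"
  shows "bilinear (christoffel D p)"
    and "X \<in> vector_fields M \<Longrightarrow> Y \<in> vector_fields M \<Longrightarrow>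
      D X Y p = along X Y p + christoffel D p (X p) (Y p)"
proof -
  have comp: "smooth_on M (\<lambda>q. Y q \<bullet> b)" if "Y \<in> vector_fields M" for Y and b :: 'a
    using smooth_on_bounded_linear[OF openM bounded_linear_inner_left, of Y b] that
    by (simp add: vector_fields_def)
  have left: "D X Y p = (\<Sum>b\<in>Basis. (X p \<bullet> b) *\<^sub>R D (\<lambda>_. b) Y p)"
    if "X \<in> vector_fields M" "Y \<in> vector_fields M" for X Y
    using affine_connection_sum_left[where c = "\<lambda>b. b" and f = "\<lambda>b q. X q \<bullet> b",
        OF that(2) assms finite_Basis comp[OF that(1)]]
    by (simp add: euclidean_representation)
  have right: "D X Y p = along X Y p + (\<Sum>c\<in>Basis. (Y p \<bullet> c) *\<^sub>R D X (\<lambda>_. c) p)"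
    if "X \<in> vector_fields M" "Y \<in> vector_fields M" for X Y
  proof -
    have "along X (\<lambda>q. Y q \<bullet> c) p = along X Y p \<bullet> c" for c
      using frechet_derivative_at[OF has_derivative_inner_left[OF
            smooth_on_has_derivative[of M Y p], of c]] that(2) assms
      by (simp add: along_def vector_fields_def fun_eq_iff)
    then show ?thesis
      using affine_connection_sum_right[where c = "\<lambda>b. b" and f = "\<lambda>b q. Y q \<bullet> b",
          OF that(1) assms finite_Basis comp[OF that(2)]]
      by (simp add: euclidean_representation sum.distrib)
  qed
  have lin: "linear (\<lambda>u. \<Sum>b\<in>Basis. (u \<bullet> b) *\<^sub>R c b)" for c :: "'a \<Rightarrow> 'a"
    by (rule linearI) (simp_all add: inner_add_left scaleR_left_distrib sum.distrib scaleR_sum_right)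
  have linl: "linear (\<lambda>u. christoffel D p u v)" for v
  proof -
    have "christoffel D p u v = (\<Sum>b\<in>Basis. (u \<bullet> b) *\<^sub>R D (\<lambda>_. b) (\<lambda>_. v) p)" for u
      using left[OF const_vector_field const_vector_field, of u v] by (simp add: christoffel_def)
    then show ?thesis using lin by simp
  qed
  have linr: "linear (\<lambda>v. christoffel D p u v)" for u
  proof -
    have "christoffel D p u v = (\<Sum>b\<in>Basis. (v \<bullet> b) *\<^sub>R D (\<lambda>_. u) (\<lambda>_. b) p)" for v
      using right[OF const_vector_field const_vector_field, of u v] by (simp add: christoffel_def)
    then show ?thesis using lin by simp
  qed
  show "bilinear (christoffel D p)" using linl linr by (simp add: bilinear_def)
  assume X: "X \<in> vector_fields M" and Y: "Y \<in> vector_fields M"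
  have "D (\<lambda>_. b) Y p = frechet_derivative Y (at p) b + christoffel D p b (Y p)" for b
    using right[OF const_vector_field Y, of b] linear_field_expand[of "\<lambda>_. christoffel D p b" p "Y p"] linr[of b]
    by (simp add: christoffel_def along_def)
  then have "D X Y p = (\<Sum>b\<in>Basis. (X p \<bullet> b) *\<^sub>R frechet_derivative Y (at p) b)
      + (\<Sum>b\<in>Basis. (X p \<bullet> b) *\<^sub>R christoffel D p b (Y p))"
    using left[OF X Y] by (simp add: scaleR_right_distrib sum.distrib)
  moreover have "linear (frechet_derivative Y (at p))"
    using Y assms by (intro frechet_derivative_linear[of M]) (simp_all add: vector_fields_def)
  ultimately show "D X Y p = along X Y p + christoffel D p (X p) (Y p)"
    using linear_field_expand[of "\<lambda>q. frechet_derivative Y (at p)" p "X p"]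
      linear_field_expand[of "\<lambda>q u. christoffel D q u (Y p)" p "X p"] linl[of "Y p"]
    by (simp add: along_def)
qed

lemmas bilinear_christoffel = affine_connection_eq_christoffel_bilinear(1)
lemmas affine_connection_eq_christoffel = affine_connection_eq_christoffel_bilinear(2)

lemma affine_connection_local:
  assumes "p \<in> M" "X \<in> vector_fields M" "Y \<in> vector_fields M"
    and "\<And>q. q \<in> M \<Longrightarrow> X' q = X q" "\<And>q. q \<in> M \<Longrightarrow> Y' q = Y q"
  shows "D X' Y' p = D X Y p"
proof -
  have "X' \<in> vector_fields M" "Y' \<in> vector_fields M"
    using assms smooth_on_cong[OF openM, of X' X] smooth_on_cong[OF openM, of Y' Y]
    by (auto simp: vector_fields_def)
  then show ?thesis
    using affine_connection_eq_christoffel[OF assms(1), of X Y]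
      affine_connection_eq_christoffel[OF assms(1), of X' Y'] assms
      frechet_derivative_cong_open[OF openM assms(1) assms(5)]
    by (simp add: along_def)
qed

text \<open>The second derivatives of \<open>Z\<close> cancel by their symmetry and the first derivatives of all three fields
  cancel against the bracket term, which leaves an expression in the values at \<open>p\<close>.\<close>

lemma curvature_eq_christoffel:
  assumes p: "p \<in> M" and X: "X \<in> vector_fields M" and Y: "Y \<in> vector_fields M" and Z: "Z \<in> vector_fields M"
  defines "\<Gamma> \<equiv> christoffel D"
  shows "curvature D X Y Z p =
      frechet_derivative (\<lambda>q. \<Gamma> q (Y p) (Z p)) (at p) (X p)
    - frechet_derivative (\<lambda>q. \<Gamma> q (X p) (Z p)) (at p) (Y p)
    + \<Gamma> p (X p) (\<Gamma> p (Y p) (Z p)) - \<Gamma> p (Y p) (\<Gamma> p (X p) (Z p))"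
proof -
  let ?d = "\<lambda>f. frechet_derivative f (at p)"
  have bil: "bilinear (\<Gamma> q)" if "q \<in> M" for q unfolding \<Gamma>_def using bilinear_christoffel[OF that] .
  have lr: "linear (\<Gamma> p u)" and ll: "linear (\<lambda>u. \<Gamma> p u v)" for u v 
    using bil[OF p] by (simp_all add: bilinear_def)
  have sm: "smooth_on M (\<lambda>q. \<Gamma> q u v)" for u v
    unfolding \<Gamma>_def by (rule smooth_on_christoffel)
  have Zs: "smooth_on M Z" using Z by (simp add: vector_fields_def)
  have linZ: "linear (frechet_derivative Z (at q))" if "q \<in> M" for q
    by (rule frechet_derivative_linear[OF Zs that])
  have iter: "D A (D B Z) p = ?d (\<lambda>q. frechet_derivative Z (at q) (B p)) (A p) + ?d Z (?d B (A p))
      + ?d (\<lambda>q. \<Gamma> q (B p) (Z p)) (A p) + \<Gamma> p (?d B (A p)) (Z p) + \<Gamma> p (B p) (?d Z (A p))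
      + \<Gamma> p (A p) (?d Z (B p)) + \<Gamma> p (A p) (\<Gamma> p (B p) (Z p))"
    if A: "A \<in> vector_fields M" and B: "B \<in> vector_fields M" for A B
  proof -
    have Bs: "smooth_on M B" using B by (simp add: vector_fields_def)
    note d1 = has_derivative_linear_field_apply[OF openM linZ smooth_on_frechet_derivative[OF Zs] Bs p]
    note d2 = smooth_on_has_derivative[OF smooth_on_bilinear_field_apply[OF openM bil sm Bs Zs] p]
    have "?d (D B Z) = ?d (\<lambda>q. frechet_derivative Z (at q) (B q) + \<Gamma> q (B q) (Z q))"
      using affine_connection_eq_christoffel[OF _ B Z]
      by (intro frechet_derivative_cong_open[OF openM p]) (simp add: along_def \<Gamma>_def)
    also have "\<dots> = (\<lambda>h. (?d (\<lambda>q. frechet_derivative Z (at q) (B p)) h + ?d Z (?d B h))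
         + ?d (\<lambda>q. \<Gamma> q (B q) (Z q)) h)"
      by (rule frechet_derivative_at[OF has_derivative_add[OF d1 d2], symmetric])
    finally have "?d (D B Z) (A p) = ?d (\<lambda>q. frechet_derivative Z (at q) (B p)) (A p) + ?d Z (?d B (A p))
         + (?d (\<lambda>q. \<Gamma> q (B p) (Z p)) (A p) + \<Gamma> p (?d B (A p)) (Z p) + \<Gamma> p (B p) (?d Z (A p)))"
      by (simp add: frechet_derivative_bilinear_field_apply[OF openM bil sm Bs Zs p])
    moreover have "D B Z p = ?d Z (B p) + \<Gamma> p (B p) (Z p)"
      using affine_connection_eq_christoffel[OF p B Z] by (simp add: along_def \<Gamma>_def)
    moreover have "D A (D B Z) p = ?d (D B Z) (A p) + \<Gamma> p (A p) (D B Z p)"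
      using affine_connection_eq_christoffel[OF p A affine_connection_smooth[OF B Z]]
      by (simp add: along_def \<Gamma>_def)
    ultimately show ?thesis by (simp add: linear_add[OF lr])
  qed
  have "lie_bracket X Y \<in> vector_fields M"
    using smooth_on_lie_bracket[OF openM] X Y by (simp add: vector_fields_def)
  then have "D (lie_bracket X Y) Z p = ?d Z (lie_bracket X Y p) + \<Gamma> p (lie_bracket X Y p) (Z p)"
    using affine_connection_eq_christoffel[OF p _ Z] by (simp add: along_def \<Gamma>_def)
  then have br: "D (lie_bracket X Y) Z p = ?d Z (?d Y (X p)) - ?d Z (?d X (Y p)) 
     + \<Gamma> p (?d Y (X p)) (Z p) - \<Gamma> p (?d X (Y p)) (Z p)"
    by (simp add: lie_bracket_def along_def linear_diff[OF linZ[OF p]] linear_diff[OF ll])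
  have sym: "?d (\<lambda>q. frechet_derivative Z (at q) (Y p)) (X p) = ?d (\<lambda>q. frechet_derivative Z (at q) (X p)) (Y p)"
    by (rule second_derivative_symmetric[OF openM Zs p])
  show ?thesis
    unfolding curvature_def iter[OF X Y] iter[OF Y X] br sym by (simp add: algebra_simps)
qed

lemma covariant_derivative_metric_eq_christoffel:
  assumes g: "riemannian_metric M g" and p: "p \<in> M"
    and X: "X \<in> vector_fields M" and Y: "Y \<in> vector_fields M" and Z: "Z \<in> vector_fields M"
  shows "covariant_derivative_metric g D X Y Z p =
      frechet_derivative (\<lambda>q. g q (Y p) (Z p)) (at p) (X p)
    - g p (christoffel D p (X p) (Y p)) (Z p) - g p (Y p) (christoffel D p (X p) (Z p))"
proof -
  have bil: "\<And>q. q \<in> M \<Longrightarrow> bilinear (g q)" and sm: "\<And>u v. smooth_on M (\<lambda>q. g q u v)"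
    using g by (auto simp: riemannian_metric_def)
  have s: "smooth_on M Y" "smooth_on M Z" using Y Z by (auto simp: vector_fields_def)
  have gl: "g p (u + u') v = g p u v + g p u' v" "g p v (u + u') = g p v u + g p v u'" for u u' v
    using bilinear_ladd[OF bil[OF p]] bilinear_radd[OF bil[OF p]] by auto
  show ?thesis
    using affine_connection_eq_christoffel[OF p X Y] affine_connection_eq_christoffel[OF p X Z]
    by (simp add: covariant_derivative_metric_def along_def gl
        frechet_derivative_bilinear_field_apply[OF openM bil sm s p])
qed

end

lemma affine_connection_christoffel_connection:
  assumes "open M" and bil: "\<And>q. q \<in> M \<Longrightarrow> bilinear (\<Gamma> q)"
    and sm: "\<And>u v. smooth_on M (\<lambda>q. \<Gamma> q u v)"
  shows "affine_connection M (christoffel_connection \<Gamma>)"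
proof -
  have lin: "\<Gamma> p (u + u') v = \<Gamma> p u v + \<Gamma> p u' v" "\<Gamma> p (r *\<^sub>R u) v = r *\<^sub>R \<Gamma> p u v"
    "\<Gamma> p u (v + v') = \<Gamma> p u v + \<Gamma> p u v'" "\<Gamma> p u (r *\<^sub>R v) = r *\<^sub>R \<Gamma> p u v" if "p \<in> M" for p u u' v v' r
    using bil[OF that] by (simp_all add: bilinear_ladd bilinear_lmul bilinear_radd bilinear_rmul)
  have dl: "linear (frechet_derivative Y (at p))" if "smooth_on M Y" "p \<in> M" for Y :: "'a \<Rightarrow> 'a" and p
    by (rule frechet_derivative_linear[OF that])
  have da: "frechet_derivative (\<lambda>q. Y q + Y' q) (at p) h = frechet_derivative Y (at p) h + frechet_derivative Y' (at p) h"
    if "smooth_on M Y" "smooth_on M Y'" "p \<in> M" for Y Y' :: "'a \<Rightarrow> 'a" and p h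
    using frechet_derivative_at[OF has_derivative_add[OF smooth_on_has_derivative[OF that(1,3)] 
          smooth_on_has_derivative[OF that(2,3)]]] by (simp add: fun_eq_iff)
  have ds: "frechet_derivative (\<lambda>q. f q *\<^sub>R Y q) (at p) h = f p *\<^sub>R frechet_derivative Y (at p) h + frechet_derivative f (at p) h *\<^sub>R Y p"
    if "smooth_on M f" "smooth_on M Y" "p \<in> M" for f and Y :: "'a \<Rightarrow> 'a" and p h
    using frechet_derivative_at[OF has_derivative_scaleR[OF smooth_on_has_derivative[OF that(1,3)] 
          smooth_on_has_derivative[OF that(2,3)]]] by (simp add: fun_eq_iff)
  have "smooth_on M (christoffel_connection \<Gamma> X Y)" if "smooth_on M X" "smooth_on M Y" for X Y
    using smooth_on_add[OF assms(1) smooth_on_along[OF assms(1) that] 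
        smooth_on_bilinear_field_apply[OF assms(1) bil sm that]]
    by (simp add: christoffel_connection_def[abs_def])
  then show ?thesis
    unfolding affine_connection_def vector_fields_def
    by (auto simp: christoffel_connection_def along_def lin da ds linear_add[OF dl] linear_scale[OF dl] algebra_simps)
qed

lemma christoffel_christoffel_connection [simp]: 
  "christoffel (christoffel_connection \<Gamma>) = \<Gamma>"
  by (simp add: christoffel_def christoffel_connection_def fun_eq_iff)

text \<open>The Koszul formula for constant fields, whose brackets vanish. It shows that a statistical
  connection is determined by the metric and the cubic form \<open>\<nabla> g\<close>.\<close>

lemma statistical_structure_koszul:
  assumes "open M" and stat: "statistical_structure M g D" and p: "p \<in> M"
  shows "2 * g p (christoffel D p u v) w =
      frechet_derivative (\<lambda>q. g q v w) (at p) u + frechet_derivative (\<lambda>q. g q u w) (at p) v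
    - frechet_derivative (\<lambda>q. g q u v) (at p) w
    - covariant_derivative_metric g D (\<lambda>_. u) (\<lambda>_. v) (\<lambda>_. w) p"
proof -
  have g: "riemannian_metric M g" and aff: "affine_connection M D" and tf: "torsion_free M D"
    using stat by (auto simp: statistical_structure_def)
  let ?C = "\<lambda>u v w. covariant_derivative_metric g D (\<lambda>_. u) (\<lambda>_. v) (\<lambda>_. w) p"
  have C: "?C u v w = frechet_derivative (\<lambda>q. g q v w) (at p) u
    - g p (christoffel D p u v) w - g p v (christoffel D p u w)" for u v w
    by (simp add: covariant_derivative_metric_eq_christoffel[OF assms(1) aff g p])
  have "?C u v w = ?C v u w \<and> ?C u v w = ?C u w v" for u v w
    using stat p const_vector_field unfolding statistical_structure_def by blast
  then have sym: "?C v u w = ?C u v w" "?C w u v = ?C u v w" by metis+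
  have tor: "christoffel D p u v = christoffel D p v u" for u v
  proof -
    have "D (\<lambda>_. u) (\<lambda>_. v) p - D (\<lambda>_. v) (\<lambda>_. u) p = lie_bracket (\<lambda>_. u) (\<lambda>_. v) p"
      using tf p const_vector_field unfolding torsion_free_def by blast
    then show ?thesis by (simp add: christoffel_def lie_bracket_def)
  qed
  have gs: "g p u v = g p v u" for u v using g p by (auto simp: riemannian_metric_def)
  show ?thesis
    using C[of u v w] C[of v u w] C[of w u v] sym tor[of w u] tor[of w v] tor[of v u]
      gs[of v "christoffel D p u w"] gs[of u "christoffel D p v w"]
    by simp
qed

section \<open>Moments of the score\<close>

lemma has_bochner_integral_lborel_prod:
  fixes f :: "'a::euclidean_space \<Rightarrow> real \<Rightarrow> real"
  assumes int: "\<And>b. b \<in> Basis \<Longrightarrow> integrable lborel (f b)"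
  shows "has_bochner_integral lborel (\<lambda>x::'a. \<Prod>b\<in>Basis. f b (x \<bullet> b)) (\<Prod>b\<in>Basis. LINT t|lborel. f b t)"
proof -
  interpret product_sigma_finite "\<lambda>_::'a. lborel :: real measure" ..
  \<comment> \<open>\<open>lborel\<close> is the image of a finite product of one-dimensional measures under \<open>?T\<close>\<close>
  let ?T = "\<lambda>h::'a \<Rightarrow> real. \<Sum>b\<in>Basis. h b *\<^sub>R b"
  have lb: "(lborel :: 'a measure) = distr (\<Pi>\<^sub>M b\<in>Basis. lborel) borel ?T"
    by (rule lborel_eq)
  have T: "?T \<in> measurable (\<Pi>\<^sub>M b\<in>(Basis::'a set). lborel) borel" by measurable
  have fm: "(\<lambda>x::'a. \<Prod>b\<in>Basis. f b (x \<bullet> b)) \<in> borel_measurable borel"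
  proof (rule borel_measurable_prod)
    fix b :: 'a assume "b \<in> Basis"
    have "f b \<in> borel_measurable borel" using int[OF \<open>b \<in> Basis\<close>] by simp
    then show "(\<lambda>x. f b (x \<bullet> b)) \<in> borel_measurable borel" by measurable
  qed
  have eq: "(\<Prod>b\<in>Basis. f b (?T h \<bullet> b)) = (\<Prod>b\<in>Basis. f b (h b))" for h
    by (intro prod.cong refl) (simp add: inner_sum_left inner_Basis if_distrib[of "(*) _"] sum.delta cong: if_cong)
  have "integrable (\<Pi>\<^sub>M b\<in>(Basis::'a set). lborel) (\<lambda>h. \<Prod>b\<in>Basis. f b (h b))"
    by (rule product_integrable_prod[OF finite_Basis int])
  then have 1: "integrable lborel (\<lambda>x::'a. \<Prod>b\<in>Basis. f b (x \<bullet> b))"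
    unfolding lb integrable_distr_eq[OF T fm] eq .
  have "integral\<^sup>L lborel (\<lambda>x::'a. \<Prod>b\<in>Basis. f b (x \<bullet> b)) = (\<integral>h. (\<Prod>b\<in>Basis. f b (h b)) \<partial>(\<Pi>\<^sub>M b\<in>(Basis::'a set). lborel))"
    unfolding lb integral_distr[OF T fm] eq ..
  also have "\<dots> = (\<Prod>b\<in>Basis. LINT t|lborel. f b t)"
    by (rule product_integral_prod[OF finite_Basis int])
  finally show ?thesis using 1 by (simp add: has_bochner_integral_iff)
qed

lemma integrable_normal_density_poly:
  "0 < \<sigma> \<Longrightarrow> integrable lborel (\<lambda>t. normal_density \<mu> \<sigma> t * poly p (t - \<mu>))"
  by (auto simp: poly_altdef sum_distrib_left mult.left_commute[of "normal_density _ _ _"]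
      intro!: Bochner_Integration.integrable_sum integrable_mult_right integrable_normal_moment)

text \<open>Expectations of sums over the coordinates: a product in which some coordinate occurs exactly once
  vanishes by independence, because the factor at that coordinate has mean zero. Hence only the
  diagonal terms survive, for two and for three factors alike.\<close>

context
  fixes c :: "'a::euclidean_space" and \<sigma> :: real
  assumes \<sigma>: "0 < \<sigma>"
begin

private abbreviation (input) n where "n b \<equiv> normal_density (c \<bullet> b) \<sigma>"
private abbreviation (input) E where "E b P \<equiv> LINT t|lborel. n b t * poly P (t - c \<bullet> b)"

private lemma E_one: "E b 1 = 1"
  using integral_normal_moment_even[OF \<sigma>, of "c \<bullet> b" 0] by simp

private lemma E_prod:
  "has_bochner_integral lborel (\<lambda>x. \<Prod>b\<in>Basis. n b (x \<bullet> b) * poly (P b) (x \<bullet> b - c \<bullet> b)) (\<Prod>b\<in>Basis. E b (P b))"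
  by (rule has_bochner_integral_lborel_prod[of "\<lambda>b t. n b t * poly (P b) (t - c \<bullet> b)"])
    (rule integrable_normal_density_poly[OF \<sigma>])

private lemma prod_delta: 
  "i \<in> Basis \<Longrightarrow> (\<Prod>b\<in>Basis. poly (if b = i then U b else 1) (y b)) = (poly (U i) (y i) :: real)" for y :: "'a \<Rightarrow> real"
proof -
  assume "i \<in> Basis"
  have "(\<Prod>b\<in>Basis. poly (if b = i then U b else 1) (y b)) = (\<Prod>b\<in>Basis. if b = i then poly (U b) (y b) else 1)"
    by (intro prod.cong) auto
  then show ?thesis using \<open>i \<in> Basis\<close> by (simp add: prod.delta)
qed

lemma has_bochner_integral_two_independent_sums:
  assumes U: "\<And>b. b \<in> Basis \<Longrightarrow> E b (U b) = 0" and V: "\<And>b. b \<in> Basis \<Longrightarrow> E b (V b) = 0"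
  shows "has_bochner_integral lborel
    (\<lambda>x. (\<Sum>b\<in>Basis. poly (U b) (x \<bullet> b - c \<bullet> b)) * (\<Sum>b\<in>Basis. poly (V b) (x \<bullet> b - c \<bullet> b)) * (\<Prod>b\<in>Basis. n b (x \<bullet> b)))
    (\<Sum>b\<in>Basis. E b (U b * V b))"
proof -
  define P where "P i j b = (if b = i then U b else 1) * (if b = j then V b else 1)" for i j b
  have 1: "poly (U i) (x \<bullet> i - c \<bullet> i) * poly (V j) (x \<bullet> j - c \<bullet> j) * (\<Prod>b\<in>Basis. n b (x \<bullet> b))
    = (\<Prod>b\<in>Basis. n b (x \<bullet> b) * poly (P i j b) (x \<bullet> b - c \<bullet> b))" if "i \<in> Basis" "j \<in> Basis" for i j x
    using that by (simp add: P_def prod.distrib prod_delta[of _ _ "\<lambda>b. x \<bullet> b - c \<bullet> b"])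
  have 2: "(\<Prod>b\<in>Basis. E b (P i j b)) = (if j = i then E i (U i * V i) else 0)" if ij: "i \<in> Basis" "j \<in> Basis" for i j
  proof (cases "j = i")
    case True
    have "(\<Prod>b\<in>Basis. E b (P i j b)) = (\<Prod>b\<in>Basis. if b = i then E b (U b * V b) else 1)"
      by (intro prod.cong refl) (use True E_one in \<open>auto simp: P_def\<close>)
    then show ?thesis using True ij by (simp add: prod.delta)
  next
    case False
    then have "E i (P i j i) = 0" using U ij by (simp add: P_def)
    then have 0: "(\<Prod>b\<in>Basis. E b (P i j b)) = 0" using ij by (intro prod_zero) auto
    show ?thesis unfolding 0 using False by auto
  qed
  have "has_bochner_integral lborel
    (\<lambda>x. \<Sum>i\<in>Basis. \<Sum>j\<in>Basis. \<Prod>b\<in>Basis. n b (x \<bullet> b) * poly (P i j b) (x \<bullet> b - c \<bullet> b))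
    (\<Sum>i\<in>Basis. \<Sum>j\<in>Basis. \<Prod>b\<in>Basis. E b (P i j b))"
    by (intro has_bochner_integral_sum E_prod)
  also have "(\<Sum>i\<in>Basis. \<Sum>j\<in>Basis. \<Prod>b\<in>Basis. E b (P i j b)) = (\<Sum>i\<in>Basis. E i (U i * V i))"
    by (intro sum.cong refl) (simp add: 2 sum.delta)
  also have "(\<lambda>x. \<Sum>i\<in>Basis. \<Sum>j\<in>Basis. \<Prod>b\<in>Basis. n b (x \<bullet> b) * poly (P i j b) (x \<bullet> b - c \<bullet> b))
    = (\<lambda>x. (\<Sum>b\<in>Basis. poly (U b) (x \<bullet> b - c \<bullet> b)) * (\<Sum>b\<in>Basis. poly (V b) (x \<bullet> b - c \<bullet> b)) * (\<Prod>b\<in>Basis. n b (x \<bullet> b)))"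
    unfolding sum_product unfolding sum_distrib_right by (intro ext sum.cong refl) (simp add: 1)
  finally show ?thesis .
qed

lemma has_bochner_integral_three_independent_sums:
  assumes U: "\<And>b. b \<in> Basis \<Longrightarrow> E b (U b) = 0" and V: "\<And>b. b \<in> Basis \<Longrightarrow> E b (V b) = 0"
    and W: "\<And>b. b \<in> Basis \<Longrightarrow> E b (W b) = 0"
  shows "has_bochner_integral lborel
    (\<lambda>x. (\<Sum>b\<in>Basis. poly (U b) (x \<bullet> b - c \<bullet> b)) * (\<Sum>b\<in>Basis. poly (V b) (x \<bullet> b - c \<bullet> b))
       * (\<Sum>b\<in>Basis. poly (W b) (x \<bullet> b - c \<bullet> b)) * (\<Prod>b\<in>Basis. n b (x \<bullet> b)))
    (\<Sum>b\<in>Basis. E b (U b * V b * W b))"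
proof -
  define P where "P i j k b = (if b = i then U b else 1) * (if b = j then V b else 1) * (if b = k then W b else 1)" for i j k b
  have 1: "poly (U i) (x \<bullet> i - c \<bullet> i) * poly (V j) (x \<bullet> j - c \<bullet> j) * poly (W k) (x \<bullet> k - c \<bullet> k) * (\<Prod>b\<in>Basis. n b (x \<bullet> b))
    = (\<Prod>b\<in>Basis. n b (x \<bullet> b) * poly (P i j k b) (x \<bullet> b - c \<bullet> b))" if "i \<in> Basis" "j \<in> Basis" "k \<in> Basis" for i j k x
    using that by (simp add: P_def prod.distrib prod_delta[of _ _ "\<lambda>b. x \<bullet> b - c \<bullet> b"])
  have 2: "(\<Prod>b\<in>Basis. E b (P i j k b)) = (if j = i then if k = i then E i (U i * V i * W i) else 0 else 0)"
    if ijk: "i \<in> Basis" "j \<in> Basis" "k \<in> Basis" for i j k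
  proof (cases "j = i \<and> k = i")
    case True
    have "(\<Prod>b\<in>Basis. E b (P i j k b)) = (\<Prod>b\<in>Basis. if b = i then E b (U b * V b * W b) else 1)"
      by (intro prod.cong refl) (use True E_one in \<open>auto simp: P_def\<close>)
    then show ?thesis using True ijk by (simp add: prod.delta)
  next
    case False
    \<comment> \<open>In each of the three cases some index differs from both others; the factor there has mean zero.\<close>
    then consider "j \<noteq> i" "k \<noteq> i" | "j \<noteq> i" "k = i" | "j = i" "k \<noteq> i" by blast
    then have "\<exists>b\<in>Basis. E b (P i j k b) = 0"
    proof cases
      case 1 then show ?thesis using U ijk by (intro bexI[of _ i]) (simp_all add: P_def)
    next
      case 2 then show ?thesis using V ijk by (intro bexI[of _ j]) (simp_all add: P_def)
    next
      case 3 then show ?thesis using W ijk by (intro bexI[of _ k]) (simp_all add: P_def)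
    qed
    then have 0: "(\<Prod>b\<in>Basis. E b (P i j k b)) = 0" by (intro prod_zero) auto
    show ?thesis unfolding 0 using False by auto
  qed
  have "has_bochner_integral lborel
    (\<lambda>x. \<Sum>i\<in>Basis. \<Sum>k\<in>Basis. \<Sum>j\<in>Basis. \<Prod>b\<in>Basis. n b (x \<bullet> b) * poly (P i j k b) (x \<bullet> b - c \<bullet> b))
    (\<Sum>i\<in>Basis. \<Sum>k\<in>Basis. \<Sum>j\<in>Basis. \<Prod>b\<in>Basis. E b (P i j k b))"
    by (intro has_bochner_integral_sum E_prod)
  also have "(\<Sum>i\<in>Basis. \<Sum>k\<in>Basis. \<Sum>j\<in>Basis. \<Prod>b\<in>Basis. E b (P i j k b)) = (\<Sum>i\<in>Basis. E i (U i * V i * W i))"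
    by (intro sum.cong refl) (simp add: 2 sum.delta)
  also have "(\<lambda>x. \<Sum>i\<in>Basis. \<Sum>k\<in>Basis. \<Sum>j\<in>Basis. \<Prod>b\<in>Basis. n b (x \<bullet> b) * poly (P i j k b) (x \<bullet> b - c \<bullet> b))
    = (\<lambda>x. (\<Sum>b\<in>Basis. poly (U b) (x \<bullet> b - c \<bullet> b)) * (\<Sum>b\<in>Basis. poly (V b) (x \<bullet> b - c \<bullet> b))
       * (\<Sum>b\<in>Basis. poly (W b) (x \<bullet> b - c \<bullet> b)) * (\<Prod>b\<in>Basis. n b (x \<bullet> b)))"
    unfolding sum_product unfolding sum_distrib_right by (intro ext sum.cong refl) (simp add: 1)
  finally show ?thesis .
qed

end

text \<open>The Gaussian moments up to order six, which suffice for products of three scores.\<close>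

lemma integral_normal_density_sextic:
  assumes s: "0 < s"
  shows "(LINT t|lborel. normal_density \<mu> (sqrt s) t *
      (c0 + c1 * (t - \<mu>) + c2 * (t - \<mu>)^2 + c3 * (t - \<mu>)^3 + c4 * (t - \<mu>)^4 + c5 * (t - \<mu>)^5 + c6 * (t - \<mu>)^6))
    = c0 + c2 * s + 3 * c4 * s^2 + 15 * c6 * s^3"
proof -
  have "0 < sqrt s" using s by simp
  note ev = normal_moment_even[OF this, of \<mu>] and od = normal_moment_odd[OF this, of \<mu>]
  have "has_bochner_integral lborel (\<lambda>t. c0 * (normal_density \<mu> (sqrt s) t * (t - \<mu>)^(2*0))
     + c1 * (normal_density \<mu> (sqrt s) t * (t - \<mu>)^(2*0+1)) + c2 * (normal_density \<mu> (sqrt s) t * (t - \<mu>)^(2*1))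
     + c3 * (normal_density \<mu> (sqrt s) t * (t - \<mu>)^(2*1+1)) + c4 * (normal_density \<mu> (sqrt s) t * (t - \<mu>)^(2*2))
     + c5 * (normal_density \<mu> (sqrt s) t * (t - \<mu>)^(2*2+1)) + c6 * (normal_density \<mu> (sqrt s) t * (t - \<mu>)^(2*3)))
     (c0 * (fact (2*0) / ((2 / (sqrt s)\<^sup>2)^0 * fact 0)) + c1 * 0 + c2 * (fact (2*1) / ((2 / (sqrt s)\<^sup>2)^1 * fact 1)) + c3 * 0
     + c4 * (fact (2*2) / ((2 / (sqrt s)\<^sup>2)^2 * fact 2)) + c5 * 0 + c6 * (fact (2*3) / ((2 / (sqrt s)\<^sup>2)^3 * fact 3)))"
    by (intro has_bochner_integral_add has_bochner_integral_mult_right ev od)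
  then have "(LINT t|lborel. c0 * (normal_density \<mu> (sqrt s) t * (t - \<mu>)^(2*0))
     + c1 * (normal_density \<mu> (sqrt s) t * (t - \<mu>)^(2*0+1)) + c2 * (normal_density \<mu> (sqrt s) t * (t - \<mu>)^(2*1))
     + c3 * (normal_density \<mu> (sqrt s) t * (t - \<mu>)^(2*1+1)) + c4 * (normal_density \<mu> (sqrt s) t * (t - \<mu>)^(2*2))
     + c5 * (normal_density \<mu> (sqrt s) t * (t - \<mu>)^(2*2+1)) + c6 * (normal_density \<mu> (sqrt s) t * (t - \<mu>)^(2*3)))
    = c0 + c2 * s + 3 * c4 * s^2 + 15 * c6 * s^3"
    using s by (simp add: has_bochner_integral_iff fact_numeral power_divide)
  moreover have "n * (c0 + c1 * y + c2 * y^2 + c3 * y^3 + c4 * y^4 + c5 * y^5 + c6 * y^6)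
    = c0 * (n * y^(2*0)) + c1 * (n * y^(2*0+1)) + c2 * (n * y^(2*1)) + c3 * (n * y^(2*1+1))
     + c4 * (n * y^(2*2)) + c5 * (n * y^(2*2+1)) + c6 * (n * y^(2*3))" for n y :: real
    by (simp add: algebra_simps power2_eq_square power3_eq_cube)
  ultimately show ?thesis by presburger
qed

section \<open>Fisher metric and Amari-Chentsov tensor in coordinates\<close>

lemma open_takano_space: "open (takano_space :: (real \<times> (real^'m)) set)"
  unfolding takano_space_def by (intro open_Collect_less continuous_intros)

lemma score_eq:
  fixes p v :: "real \<times> (real^'m)"
  assumes "p \<in> takano_space"
  shows "score p v x = fst v / (2 * (fst p)\<^sup>2) * ((x - snd p) \<bullet> (x - snd p))
     - real CARD('m) * fst v / (2 * fst p) + snd v \<bullet> (x - snd p) / fst p"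
proof -
  have s: "0 < fst p" using assms by (simp add: takano_space_def)
  let ?F = "\<lambda>\<theta>::real \<times> (real^'m). - real CARD('m) / 2 * ln (2 * pi * fst \<theta>)
     - ((x - snd \<theta>) \<bullet> (x - snd \<theta>)) / (2 * fst \<theta>)"
  have eq: "?F \<theta> = ln (gaussian \<theta> x)" if "\<theta> \<in> takano_space" for \<theta> :: "real \<times> (real^'m)"
    using that by (simp add: gaussian_def takano_space_def ln_mult ln_powr dot_square_norm)
  have "(?F has_derivative (\<lambda>v. fst v / (2 * (fst p)\<^sup>2) * ((x - snd p) \<bullet> (x - snd p))
     - real CARD('m) * fst v / (2 * fst p) + snd v \<bullet> (x - snd p) / fst p)) (at p)"
    using s by (auto intro!: derivative_eq_intros ext simp: field_simps power2_eq_square inner_commute)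
  from has_derivative_transform_within_open[OF this open_takano_space assms eq]
  show ?thesis unfolding score_def using frechet_derivative_at by (metis (no_types, lifting))
qed

text \<open>The score is a sum over the coordinates of independent centred polynomials of degree two.\<close>

lemma score_eq_sum_poly:
  fixes p v :: "real \<times> (real^'m)"
  assumes "p \<in> takano_space"
  shows "score p v x = (\<Sum>b\<in>Basis. poly [: - fst v / (2 * fst p), snd v \<bullet> b / fst p, fst v / (2 * (fst p)\<^sup>2) :]
      (x \<bullet> b - snd p \<bullet> b))"
proof -
  let ?y = "x - snd p"
  have quad: "poly [:a, b, c:] y = a + b * y + c * (y * y)" for a b c y :: real
    by (simp add: algebra_simps)
  have "(\<Sum>b\<in>Basis. poly [: - fst v / (2 * fst p), snd v \<bullet> b / fst p, fst v / (2 * (fst p)\<^sup>2) :] (x \<bullet> b - snd p \<bullet> b))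
    = (\<Sum>b\<in>Basis. - fst v / (2 * fst p) + (snd v \<bullet> b) * (?y \<bullet> b) / fst p + fst v / (2 * (fst p)\<^sup>2) * ((?y \<bullet> b) * (?y \<bullet> b)))"
    unfolding quad inner_diff_left by simp
  also have "\<dots> = - real CARD('m) * fst v / (2 * fst p) + snd v \<bullet> ?y / fst p + fst v / (2 * (fst p)\<^sup>2) * (?y \<bullet> ?y)"
    unfolding sum.distrib sum_distrib_left[symmetric] sum_divide_distrib[symmetric] euclidean_inner[symmetric]
    by simp
  finally show ?thesis by (simp add: score_eq[OF assms])
qed

lemma gaussian_eq_prod_normal_density:
  fixes p :: "real \<times> (real^'m)"
  assumes "p \<in> takano_space"
  shows "gaussian p x = (\<Prod>b\<in>Basis. normal_density (snd p \<bullet> b) (sqrt (fst p)) (x \<bullet> b))"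
proof -
  have s: "0 < fst p" using assms by (simp add: takano_space_def)
  have "(\<Prod>b\<in>(Basis :: (real^'m) set). normal_density (snd p \<bullet> b) (sqrt (fst p)) (x \<bullet> b))
    = (1 / sqrt (2 * pi * fst p)) ^ CARD('m) * exp (\<Sum>b\<in>Basis. - (x \<bullet> b - snd p \<bullet> b)\<^sup>2 / (2 * fst p))"
    using s by (simp add: normal_density_def prod.distrib exp_sum prod_dividef power_one_over)
  also have "(\<Sum>b\<in>Basis. - (x \<bullet> b - snd p \<bullet> b)\<^sup>2 / (2 * fst p)) = - (norm (x - snd p))\<^sup>2 / (2 * fst p)"
    unfolding sum_divide_distrib[symmetric] sum_negf power2_norm_eq_inner
    unfolding euclidean_inner[of "x - snd p" "x - snd p"]
    by (simp add: inner_diff_left power2_eq_square)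
  also have "(1 / sqrt (2 * pi * fst p)) ^ CARD('m) = (2 * pi * fst p) powr (- real CARD('m) / 2)"
  proof -
    have "1 / sqrt (2 * pi * fst p) = (2 * pi * fst p) powr (- (1 / 2))"
      using s by (simp add: powr_minus_divide powr_half_sqrt)
    then show ?thesis using s by (simp add: powr_power)
  qed
  finally show ?thesis by (simp add: gaussian_def)
qed

lemma score_moments:
  fixes s \<sigma> \<tau> \<rho> \<beta> \<gamma> \<delta> \<mu> :: real
  assumes s: "0 < s"
  defines "P \<equiv> \<lambda>\<sigma> \<beta>. [: - \<sigma> / (2 * s), \<beta> / s, \<sigma> / (2 * s\<^sup>2) :]"
  shows "(LINT t|lborel. normal_density \<mu> (sqrt s) t * poly (P \<sigma> \<beta>) (t - \<mu>)) = 0"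
    and "(LINT t|lborel. normal_density \<mu> (sqrt s) t * poly (P \<sigma> \<beta> * P \<tau> \<gamma>) (t - \<mu>))
       = \<sigma> * \<tau> / (2 * s\<^sup>2) + \<beta> * \<gamma> / s"
    and "(LINT t|lborel. normal_density \<mu> (sqrt s) t * poly (P \<sigma> \<beta> * P \<tau> \<gamma> * P \<rho> \<delta>) (t - \<mu>))
       = \<sigma> * \<tau> * \<rho> / s^3 + (\<sigma> * (\<gamma> * \<delta>) + \<tau> * (\<beta> * \<delta>) + \<rho> * (\<beta> * \<gamma>)) / s\<^sup>2"
proof -
  note six = integral_normal_density_sextic[OF s, of \<mu>]
  have 1: "poly (P \<sigma> \<beta>) y = (- \<sigma> / (2 * s)) + (\<beta> / s) * y + (\<sigma> / (2 * s\<^sup>2)) * y^2 + 0 * y^3 + 0 * y^4 + 0 * y^5 + 0 * y^6" for \<sigma> \<beta> y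
    by (simp add: P_def algebra_simps power2_eq_square)
  show "(LINT t|lborel. normal_density \<mu> (sqrt s) t * poly (P \<sigma> \<beta>) (t - \<mu>)) = 0"
    unfolding 1 six using s by (simp add: field_simps power2_eq_square)
  have 2: "(a + b * y + c * y^2) * (a' + b' * y + c' * y^2)
    = a * a' + (a * b' + b * a') * y + (a * c' + b * b' + c * a') * y^2 + (b * c' + c * b') * y^3 + (c * c') * y^4 + 0 * y^5 + 0 * y^6"
    for a b c a' b' c' y :: real by algebra
  have 3: "(a + b * y + c * y^2) * (a' + b' * y + c' * y^2) * (a'' + b'' * y + c'' * y^2)
    = a * a' * a'' + (a * b' * a'' + b * a' * a'' + a * a' * b'') * y
    + (a * c' * a'' + b * b' * a'' + c * a' * a'' + (a * b' + b * a') * b'' + a * a' * c'') * y^2 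
    + ((b * c' + c * b') * a'' + (a * c' + b * b' + c * a') * b'' + (a * b' + b * a') * c'') * y^3 
    + (c * c' * a'' + (b * c' + c * b') * b'' + (a * c' + b * b' + c * a') * c'') * y^4
    + (c * c' * b'' + (b * c' + c * b') * c'') * y^5 + (c * c' * c'') * y^6"
    for a b c a' b' c' a'' b'' c'' y :: real by algebra
  have P: "poly (P \<sigma> \<beta>) y = (- \<sigma> / (2 * s)) + (\<beta> / s) * y + (\<sigma> / (2 * s\<^sup>2)) * y^2" for \<sigma> \<beta> y
    unfolding 1 by simp
  show "(LINT t|lborel. normal_density \<mu> (sqrt s) t * poly (P \<sigma> \<beta> * P \<tau> \<gamma>) (t - \<mu>))
       = \<sigma> * \<tau> / (2 * s\<^sup>2) + \<beta> * \<gamma> / s"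
    unfolding poly_mult P 2 six using s by (simp add: field_simps power2_eq_square)
  show "(LINT t|lborel. normal_density \<mu> (sqrt s) t * poly (P \<sigma> \<beta> * P \<tau> \<gamma> * P \<rho> \<delta>) (t - \<mu>))
       = \<sigma> * \<tau> * \<rho> / s^3 + (\<sigma> * (\<gamma> * \<delta>) + \<tau> * (\<beta> * \<delta>) + \<rho> * (\<beta> * \<gamma>)) / s\<^sup>2"
    unfolding poly_mult P 3 six using s by (simp add: field_simps power2_eq_square power3_eq_cube)
qed

lemma fisher_metric_eq:
  fixes p u v :: "real \<times> (real^'m)"
  assumes "p \<in> takano_space"
  shows "fisher_metric p u v = real CARD('m) * (fst u * fst v) / (2 * (fst p)\<^sup>2) + snd u \<bullet> snd v / fst p"
proof -
  have s: "0 < fst p" using assms by (simp add: takano_space_def)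
  then have ss: "0 < sqrt (fst p)" by simp
  let ?P = "\<lambda>v b. [: - fst v / (2 * fst p), snd v \<bullet> b / fst p, fst v / (2 * (fst p)\<^sup>2) :]"
  have "fisher_metric p u v = (\<Sum>b\<in>Basis. fst u * fst v / (2 * (fst p)\<^sup>2) + (snd u \<bullet> b) * (snd v \<bullet> b) / fst p)"
    unfolding fisher_metric_def score_eq_sum_poly[OF assms] gaussian_eq_prod_normal_density[OF assms]
    unfolding has_bochner_integral_two_independent_sums[where c = "snd p" and U = "?P u" and V = "?P v", OF ss score_moments(1)[OF s] score_moments(1)[OF s],
        THEN has_bochner_integral_integral_eq]
    by (simp only: score_moments(2)[OF s])
  also have "\<dots> = real CARD('m) * (fst u * fst v) / (2 * (fst p)\<^sup>2) + snd u \<bullet> snd v / fst p"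
    unfolding sum.distrib sum_divide_distrib[symmetric] euclidean_inner[symmetric] by simp
  finally show ?thesis .
qed

lemma amari_chentsov_tensor_eq:
  fixes p u v w :: "real \<times> (real^'m)"
  assumes "p \<in> takano_space"
  shows "amari_chentsov_tensor \<alpha> p u v w = \<alpha> * (real CARD('m) * (fst u * fst v * fst w) / fst p ^ 3
     + (fst u * (snd v \<bullet> snd w) + fst v * (snd u \<bullet> snd w) + fst w * (snd u \<bullet> snd v)) / (fst p)\<^sup>2)"
proof -
  have s: "0 < fst p" using assms by (simp add: takano_space_def)
  then have ss: "0 < sqrt (fst p)" by simp
  let ?P = "\<lambda>v b. [: - fst v / (2 * fst p), snd v \<bullet> b / fst p, fst v / (2 * (fst p)\<^sup>2) :]"
  have "amari_chentsov_tensor \<alpha> p u v w = \<alpha> * (\<Sum>b\<in>Basis. fst u * fst v * fst w / fst p ^ 3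
     + (fst u * ((snd v \<bullet> b) * (snd w \<bullet> b)) + fst v * ((snd u \<bullet> b) * (snd w \<bullet> b)) + fst w * ((snd u \<bullet> b) * (snd v \<bullet> b))) / (fst p)\<^sup>2)"
    unfolding amari_chentsov_tensor_def score_eq_sum_poly[OF assms] gaussian_eq_prod_normal_density[OF assms]
    unfolding has_bochner_integral_three_independent_sums[where c = "snd p" and U = "?P u" and V = "?P v" and W = "?P w", OF ss score_moments(1)[OF s] score_moments(1)[OF s] score_moments(1)[OF s],
        THEN has_bochner_integral_integral_eq]
    by (simp only: score_moments(3)[OF s])
  also have "\<dots> = \<alpha> * (real CARD('m) * (fst u * fst v * fst w) / fst p ^ 3
     + (fst u * (snd v \<bullet> snd w) + fst v * (snd u \<bullet> snd w) + fst w * (snd u \<bullet> snd v)) / (fst p)\<^sup>2)"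
    unfolding sum.distrib sum_divide_distrib[symmetric] sum_distrib_left[symmetric] euclidean_inner[symmetric] by simp
  finally show ?thesis .
qed

section \<open>The Amari-Chentsov connections\<close>

text \<open>All real exponents are treated at once because the derivative lowers the exponent; the exponents
  \<open>- 1\<close> and \<open>1/2\<close> serve for the Christoffel symbols and for the invariant frame.\<close>

lemma smooth_on_takano_space_powr:
  "smooth_on (takano_space :: (real \<times> (real^'m)) set) (\<lambda>p. fst p powr r)"
proof -
  have "Ck_on k (takano_space :: (real \<times> (real^'m)) set) (\<lambda>p. fst p powr r)" for k
  proof (induction k arbitrary: r)
    case 0
    show ?case by (auto simp: takano_space_def intro!: continuous_intros)
  next
    case (Suc k)
    have "((\<lambda>p. fst p powr r) has_derivative (\<lambda>v. (r * fst v) *\<^sub>R fst p powr (r - 1))) (at p)"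
      if "p \<in> takano_space" for p :: "real \<times> (real^'m)"
    proof -
      have s: "0 < fst p" using that by (simp add: takano_space_def)
      have "((\<lambda>t. t powr r) has_derivative (\<lambda>t. r * fst p powr (r - 1) * t)) (at (fst p))"
        using has_real_derivative_powr[OF s, of r] by (simp add: has_field_derivative_def)
      from diff_chain_at[OF has_derivative_fst[OF has_derivative_ident] this]
      show ?thesis by (simp add: o_def mult_ac)
    qed
    moreover have "Ck_on k (takano_space :: (real \<times> (real^'m)) set) (\<lambda>p. (r * fst v) *\<^sub>R fst p powr (r - 1))"
      for v :: "real \<times> (real^'m)"
      by (rule Ck_on_bounded_linear[OF open_takano_space bounded_linear_scaleR_right Suc.IH])
    ultimately show ?case by (rule Ck_on_SucI[OF open_takano_space])
  qed
  then show ?thesis by (simp add: smooth_on_def)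
qed

lemma smooth_on_takano_space_inverse:
  "smooth_on (takano_space :: (real \<times> (real^'m)) set) (\<lambda>p. inverse (fst p))"
proof -
  have "inverse (fst p) = fst p powr (- 1)" if "p \<in> takano_space" for p :: "real \<times> (real^'m)"
    using that by (simp add: takano_space_def powr_minus)
  from smooth_on_cong[OF open_takano_space this, of "\<lambda>p. p"] show ?thesis
    using smooth_on_takano_space_powr[of "- 1"] by blast
qed

lemma bilinear_fisher_metric:
  "p \<in> takano_space \<Longrightarrow> bilinear (fisher_metric p)"
  by (auto simp: bilinear_def fisher_metric_eq inner_simps algebra_simps add_divide_distrib intro!: linearI)

lemma smooth_on_fisher_metric:
  fixes u v :: "real \<times> (real^'m)"
  shows "smooth_on takano_space (\<lambda>p. fisher_metric p u v)"
proof -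
  let ?i = "\<lambda>p::real \<times> (real^'m). inverse (fst p)"
  have "smooth_on takano_space (\<lambda>p. ?i p *\<^sub>R ?i p *\<^sub>R (real CARD('m) * (fst u * fst v) / 2) + ?i p *\<^sub>R (snd u \<bullet> snd v))"
    by (intro smooth_on_add smooth_on_scaleR smooth_on_const smooth_on_takano_space_inverse open_takano_space)
  then show ?thesis
    using smooth_on_cong[OF open_takano_space, of "\<lambda>p. fisher_metric p u v"
        "\<lambda>p. ?i p *\<^sub>R ?i p *\<^sub>R (real CARD('m) * (fst u * fst v) / 2) + ?i p *\<^sub>R (snd u \<bullet> snd v)"]
    by (simp add: fisher_metric_eq divide_simps power2_eq_square takano_space_def)
qed

lemma frechet_derivative_fisher_metric:
  fixes p u v w :: "real \<times> (real^'m)"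
  assumes "p \<in> takano_space"
  shows "frechet_derivative (\<lambda>q. fisher_metric q v w) (at p) u =
    - fst u * (real CARD('m) * (fst v * fst w) / fst p ^ 3 + snd v \<bullet> snd w / (fst p)\<^sup>2)"
proof -
  have s: "0 < fst p" using assms by (simp add: takano_space_def)
  have "((\<lambda>q. real CARD('m) * (fst v * fst w) / (2 * (fst q)\<^sup>2) + snd v \<bullet> snd w / fst q) has_derivative
     (\<lambda>u. - fst u * (real CARD('m) * (fst v * fst w) / fst p ^ 3 + snd v \<bullet> snd w / (fst p)\<^sup>2))) (at p)"
    using s by (auto intro!: derivative_eq_intros ext simp: field_simps power2_eq_square power3_eq_cube)
  then have "((\<lambda>q. fisher_metric q v w) has_derivative
     (\<lambda>u. - fst u * (real CARD('m) * (fst v * fst w) / fst p ^ 3 + snd v \<bullet> snd w / (fst p)\<^sup>2))) (at p)"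
    by (rule has_derivative_transform_within_open[OF _ open_takano_space assms]) (simp add: fisher_metric_eq)
  from fun_cong[OF frechet_derivative_at[OF this], of u] show ?thesis by simp
qed

lemma fisher_metric_pos:
  fixes p u :: "real \<times> (real^'m)"
  assumes "p \<in> takano_space" "u \<noteq> 0"
  shows "0 < fisher_metric p u u"
proof -
  have s: "0 < fst p" using assms by (simp add: takano_space_def)
  have "fst u \<noteq> 0 \<or> snd u \<noteq> 0" using assms(2) by (auto simp: prod_eq_iff)
  then show ?thesis
  proof
    assume "fst u \<noteq> 0"
    then have "0 < fst u * fst u" by (metis not_real_square_gt_zero)
    then have "0 < real CARD('m) * (fst u * fst u) / (2 * (fst p)\<^sup>2)"
      using s by simp
    then show ?thesis using s by (simp add: fisher_metric_eq[OF assms(1)] add_pos_nonneg)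
  next
    assume "snd u \<noteq> 0"
    then show ?thesis using s by (simp add: fisher_metric_eq[OF assms(1)] add_nonneg_pos)
  qed
qed

lemma fisher_metric_eqI:
  fixes p x y :: "real \<times> (real^'m)"
  assumes p: "p \<in> takano_space" and "\<And>w. fisher_metric p x w = fisher_metric p y w"
  shows "x = y"
proof (rule ccontr)
  assume "x \<noteq> y"
  then have "0 < fisher_metric p (x - y) (x - y)" using fisher_metric_pos[OF p] by simp
  moreover have "fisher_metric p (x - y) w = fisher_metric p x w - fisher_metric p y w" for w
    by (rule bilinear_lsub[OF bilinear_fisher_metric[OF p]])
  ultimately show False using assms(2) by simp
qed

text \<open>The Christoffel symbols of the Amari-Chentsov connection with parameter \<open>\<alpha>\<close>.\<close>

definition alpha_christoffel ::
    "real \<Rightarrow> real \<times> (real^'m) \<Rightarrow> real \<times> (real^'m) \<Rightarrow> real \<times> (real^'m) \<Rightarrow> real \<times> (real^'m)" where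
  "alpha_christoffel \<alpha> p u v =
     inverse (fst p) *\<^sub>R (- (1 + \<alpha>) * (fst u * fst v), (- (1 + \<alpha>) / 2) *\<^sub>R (fst u *\<^sub>R snd v + fst v *\<^sub>R snd u))
     + ((1 - \<alpha>) / real CARD('m) * (snd u \<bullet> snd v), 0)"

lemma bilinear_alpha_christoffel: "bilinear (alpha_christoffel \<alpha> p)"
  by (auto simp: bilinear_def alpha_christoffel_def inner_simps algebra_simps add_divide_distrib diff_divide_distrib intro!: linearI)

lemma smooth_on_alpha_christoffel: "smooth_on takano_space (\<lambda>p. alpha_christoffel \<alpha> p u v)"
  unfolding alpha_christoffel_def
  by (intro smooth_on_add smooth_on_scaleR smooth_on_const smooth_on_takano_space_inverse open_takano_space)

lemma frechet_derivative_alpha_christoffel: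
  assumes "p \<in> takano_space"
  shows "frechet_derivative (\<lambda>q. alpha_christoffel \<alpha> q v w) (at p) u =
    (fst u / (fst p)\<^sup>2) *\<^sub>R ((1 + \<alpha>) * (fst v * fst w), ((1 + \<alpha>) / 2) *\<^sub>R (fst v *\<^sub>R snd w + fst w *\<^sub>R snd v))"
proof -
  have s: "0 < fst p" using assms by (simp add: takano_space_def)
  let ?A = "(- (1 + \<alpha>) * (fst v * fst w), (- (1 + \<alpha>) / 2) *\<^sub>R (fst v *\<^sub>R snd w + fst w *\<^sub>R snd v))"
  have "((\<lambda>q. inverse (fst q)) has_derivative (\<lambda>u. - (inverse (fst p) * fst u * inverse (fst p)))) (at p)"
    using s by (intro Deriv.has_derivative_inverse[OF _ has_derivative_fst[OF has_derivative_ident]]) simp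
  then have "((\<lambda>q. alpha_christoffel \<alpha> q v w) has_derivative (\<lambda>u. - (inverse (fst p) * fst u * inverse (fst p)) *\<^sub>R ?A)) (at p)"
    unfolding alpha_christoffel_def by (rule has_derivative_add_const[OF has_derivative_scaleR_left])
  from fun_cong[OF frechet_derivative_at[OF this], of u, symmetric]
  have 1: "frechet_derivative (\<lambda>q. alpha_christoffel \<alpha> q v w) (at p) u
      = - (inverse (fst p) * fst u * inverse (fst p)) *\<^sub>R ?A" .
  have 2: "?A = - 1 *\<^sub>R ((1 + \<alpha>) * (fst v * fst w), ((1 + \<alpha>) / 2) *\<^sub>R (fst v *\<^sub>R snd w + fst w *\<^sub>R snd v))"
    unfolding scaleR_Pair scaleR_scaleR by (simp add: left_diff_distrib distrib_right)
  have 3: "- (inverse (fst p) * fst u * inverse (fst p)) * - 1 = fst u / (fst p)\<^sup>2"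
    using s by (simp add: field_simps power2_eq_square)
  show ?thesis unfolding 1 2 scaleR_scaleR[of _ "- 1"] 3 ..
qed

text \<open>Both sides satisfy the Koszul formula for the same metric and the same cubic form.\<close>

lemma amari_chentsov_christoffel:
  fixes D :: "(real \<times> (real^'m)) connection"
  assumes ac: "amari_chentsov_connection \<alpha> D" and p: "p \<in> takano_space"
  shows "christoffel D p u v = alpha_christoffel \<alpha> p u v"
proof (rule fisher_metric_eqI[OF p])
  fix w :: "real \<times> (real^'m)"
  have s: "0 < fst p" using p by (simp add: takano_space_def)
  have stat: "statistical_structure takano_space fisher_metric D" 
    and C: "covariant_derivative_metric fisher_metric D (\<lambda>_. u) (\<lambda>_. v) (\<lambda>_. w) p = amari_chentsov_tensor \<alpha> p u v w"
    using ac p by (auto simp: amari_chentsov_connection_def)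
  have "2 * fisher_metric p (christoffel D p u v) w = 2 * fisher_metric p (alpha_christoffel \<alpha> p u v) w"
    unfolding statistical_structure_koszul[OF open_takano_space stat p]
    unfolding C amari_chentsov_tensor_eq[OF p] frechet_derivative_fisher_metric[OF p] fisher_metric_eq[OF p]
    using s by (simp add: alpha_christoffel_def inner_simps field_simps power2_eq_square power3_eq_cube inner_commute)
  then show "fisher_metric p (christoffel D p u v) w = fisher_metric p (alpha_christoffel \<alpha> p u v) w" by simp
qed

text \<open>Most terms carry the product of \<open>1 + \<alpha>\<close> and \<open>1 - \<alpha>\<close> outright. The others are the derivative terms,
  linear in \<open>1 + \<alpha>\<close>, and squares of it, which combine through
  \<open>2 (1 + \<alpha>) - (1 + \<alpha>)\<^sup>2 = (1 + \<alpha>) (1 - \<alpha>)\<close>.\<close>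

lemma alpha_curvature_algebra:
  fixes p u v w :: "real \<times> (real^'m)"
  assumes "p \<in> takano_space"
  shows "frechet_derivative (\<lambda>q. alpha_christoffel \<alpha> q v w) (at p) u
    - frechet_derivative (\<lambda>q. alpha_christoffel \<alpha> q u w) (at p) v
    + alpha_christoffel \<alpha> p u (alpha_christoffel \<alpha> p v w) - alpha_christoffel \<alpha> p v (alpha_christoffel \<alpha> p u w)
    = (- (1 - \<alpha>\<^sup>2) / (2 * real CARD('m))) *\<^sub>R (fisher_metric p v w *\<^sub>R u - fisher_metric p u w *\<^sub>R v)"
proof -
  have s: "0 < fst p" using assms by (simp add: takano_space_def)
  obtain m where m: "m = real CARD('m)" "0 < m" by simp
  obtain \<sigma> a \<tau> b \<rho> c where uvw: "u = (\<sigma>, a)" "v = (\<tau>, b)" "w = (\<rho>, c)" by (metis surj_pair)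
  show ?thesis
    unfolding frechet_derivative_alpha_christoffel[OF assms] fisher_metric_eq[OF assms]
    unfolding alpha_christoffel_def m(1)[symmetric] uvw
    apply (rule prod_eqI)
    subgoal using s m(2)
      by (simp add: inner_simps field_simps power2_eq_square inner_commute)
    subgoal using s m(2)
      by (simp add: vec_eq_iff inner_simps field_simps power2_eq_square inner_commute)
    done
qed

lemma amari_chentsov_curvature:
  fixes D :: "(real \<times> (real^'m)) connection"
  assumes aff: "affine_connection takano_space D"
    and ch: "\<And>q u v. q \<in> takano_space \<Longrightarrow> christoffel D q u v = alpha_christoffel \<alpha> q u v"
    and p: "p \<in> takano_space"
    and XYZ: "X \<in> vector_fields takano_space" "Y \<in> vector_fields takano_space" "Z \<in> vector_fields takano_space"
  shows "curvature D X Y Z p = (- (1 - \<alpha>\<^sup>2) / (2 * real CARD('m))) *\<^sub>R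
    (fisher_metric p (Y p) (Z p) *\<^sub>R X p - fisher_metric p (X p) (Z p) *\<^sub>R Y p)"
proof -
  have "frechet_derivative (\<lambda>q. christoffel D q u v) (at p) = frechet_derivative (\<lambda>q. alpha_christoffel \<alpha> q u v) (at p)" for u v
    by (rule frechet_derivative_cong_open[OF open_takano_space p ch])
  then show ?thesis
    unfolding curvature_eq_christoffel[OF open_takano_space aff p XYZ] ch[OF p] alpha_curvature_algebra[OF p, symmetric]
    by simp
qed

lemma amari_chentsov_imp_constant_curvature:
  assumes "amari_chentsov_connection \<alpha> D"
  shows "constant_curvature takano_space fisher_metric D"
  unfolding constant_curvature_def
  using amari_chentsov_curvature[OF _ amari_chentsov_christoffel[OF assms]] assms
  by (auto simp: amari_chentsov_connection_def statistical_structure_def)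

text \<open>The dual of the connection with parameter \<open>\<alpha>\<close> has parameter \<open>- \<alpha>\<close>, and the curvature is an even
  function of \<open>\<alpha>\<close>.\<close>

lemma amari_chentsov_imp_conjugate_symmetric:
  assumes ac: "amari_chentsov_connection \<alpha> (D :: (real \<times> (real^'m)) connection)"
  shows "conjugate_symmetric takano_space fisher_metric D"
proof -
  let ?D' = "christoffel_connection (alpha_christoffel (- \<alpha>)) :: (real \<times> (real^'m)) connection"
  have aff: "affine_connection takano_space D"
    using ac by (auto simp: amari_chentsov_connection_def statistical_structure_def)
  have aff': "affine_connection takano_space ?D'"
    by (rule affine_connection_christoffel_connection[OF open_takano_space bilinear_alpha_christoffel smooth_on_alpha_christoffel])
  have "along X (\<lambda>q. fisher_metric q (Y q) (Z q)) p = fisher_metric p (D X Y p) (Z p) + fisher_metric p (Y p) (?D' X Z p)"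
    if X: "X \<in> vector_fields takano_space" and Y: "Y \<in> vector_fields takano_space" and Z: "Z \<in> vector_fields takano_space"
      and p: "p \<in> takano_space" for X Y Z p
  proof -
    have s: "0 < fst p" using p by (simp add: takano_space_def)
    have alg: "frechet_derivative (\<lambda>q. fisher_metric q v w) (at p) u =
       fisher_metric p (alpha_christoffel \<alpha> p u v) w + fisher_metric p v (alpha_christoffel (- \<alpha>) p u w)" for u v w
      unfolding frechet_derivative_fisher_metric[OF p] fisher_metric_eq[OF p]
      using s by (simp add: alpha_christoffel_def inner_simps field_simps power2_eq_square power3_eq_cube inner_commute)
    note bil = bilinear_fisher_metric[OF p]
    have "smooth_on takano_space Y" "smooth_on takano_space Z" using Y Z by (simp_all add: vector_fields_def)
    from frechet_derivative_bilinear_field_apply[OF open_takano_space bilinear_fisher_metric smooth_on_fisher_metric this p, of "X p"]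
    show ?thesis
      using affine_connection_eq_christoffel[OF open_takano_space aff p X Y] 
        affine_connection_eq_christoffel[OF open_takano_space aff' p X Z] amari_chentsov_christoffel[OF ac p]
      by (simp add: along_def alg bilinear_ladd[OF bil] bilinear_radd[OF bil])
  qed
  then have "dual_connection takano_space fisher_metric D ?D'"
    using aff' by (simp add: dual_connection_def)
  moreover have "curvature D X Y Z p = curvature ?D' X Y Z p" 
    if "X \<in> vector_fields takano_space" "Y \<in> vector_fields takano_space" "Z \<in> vector_fields takano_space" "p \<in> takano_space" for X Y Z p
    using amari_chentsov_curvature[OF aff amari_chentsov_christoffel[OF ac] that(4,1,2,3)]
      amari_chentsov_curvature[OF aff' _ that(4,1,2,3), of "- \<alpha>"] by simp
  ultimately show ?thesis unfolding conjugate_symmetric_def by blast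
qed

section \<open>Invariance\<close>

text \<open>The linear part of the affine map by which \<open>x \<mapsto> a x + b\<close> acts on \<open>(\<Sigma>, \<mu>)\<close>.\<close>

definition affine_linear :: "real \<Rightarrow> real \<times> (real^'m) \<Rightarrow> real \<times> (real^'m)" where
  "affine_linear a v = (a\<^sup>2 * fst v, a *\<^sub>R snd v)"

lemma bounded_linear_affine_linear: "bounded_linear (affine_linear a)"
  unfolding linear_conv_bounded_linear[symmetric]
  by (rule linearI) (auto simp: affine_linear_def algebra_simps)

lemma affine_action_eq: "affine_action a b \<theta> = affine_linear a \<theta> + (0, b)"
  by (simp add: affine_action_def affine_linear_def)

lemma frechet_derivative_affine_action: "frechet_derivative (affine_action a b) (at p) = affine_linear a"
proof -
  have "((\<lambda>\<theta>. affine_linear a \<theta> + (0, b)) has_derivative affine_linear a) (at p)"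
    by (rule has_derivative_add_const[OF bounded_linear_imp_has_derivative[OF bounded_linear_affine_linear]])
  from frechet_derivative_at[OF this, symmetric] show ?thesis
    by (simp add: affine_action_eq[abs_def])
qed

lemma affine_action_takano_space:
  "a > 0 \<Longrightarrow> affine_action a b p \<in> takano_space \<longleftrightarrow> p \<in> takano_space"
  by (simp add: affine_action_def takano_space_def zero_less_mult_iff)

lemma affine_action_inverse:
  assumes "a > 0"
  shows "affine_action (inverse a) (- inverse a *\<^sub>R b) (affine_action a b p) = p"
    and "affine_action a b (affine_action (inverse a) (- inverse a *\<^sub>R b) p) = p"
  using assms by (simp_all add: affine_action_def prod_eq_iff algebra_simps power_inverse)

lemma pushforward_affine_action:
  assumes "a > 0" "p \<in> takano_space"
  shows "pushforward takano_space (affine_action a b) X (affine_action a b p) = affine_linear a (X p)"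
proof -
  have "inj_on (affine_action a b) takano_space"
    using affine_action_inverse(1)[OF assms(1)] by (metis inj_onI)
  then show ?thesis
    using assms(2) by (simp add: pushforward_def frechet_derivative_affine_action inv_into_f_f)
qed

lemma pushforward_affine_action':
  assumes "a > 0" "q \<in> takano_space"
  shows "pushforward takano_space (affine_action a b) X q =
    affine_linear a (X (affine_action (inverse a) (- inverse a *\<^sub>R b) q))"
proof -
  let ?p = "affine_action (inverse a) (- inverse a *\<^sub>R b) q"
  have "?p \<in> takano_space"
    using affine_action_takano_space assms by (metis inverse_positive_iff_positive)
  from pushforward_affine_action[OF assms(1) this, of b X] show ?thesis
    unfolding affine_action_inverse(2)[OF assms(1)] .
qed

lemma pushforward_vector_field:
  assumes "a > 0" and X: "X \<in> vector_fields takano_space"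
  shows "pushforward takano_space (affine_action a b) X \<in> vector_fields takano_space"
proof -
  let ?c = "- inverse a *\<^sub>R b"
  have "smooth_on takano_space (\<lambda>q. X (affine_linear (inverse a) q + (0, ?c)))"
    using affine_action_takano_space[of "inverse a" ?c] assms
    by (intro smooth_on_compose_affine[OF open_takano_space bounded_linear_affine_linear, where T = takano_space])
      (auto simp: affine_action_eq vector_fields_def)
  then have "smooth_on takano_space (\<lambda>q. affine_linear a (X (affine_action (inverse a) ?c q)))"
    unfolding affine_action_eq
    by (rule smooth_on_bounded_linear[OF open_takano_space bounded_linear_affine_linear])
  moreover have "smooth_on takano_space (pushforward takano_space (affine_action a b) X)
      = smooth_on takano_space (\<lambda>q. affine_linear a (X (affine_action (inverse a) ?c q)))"
    by (rule smooth_on_cong[OF open_takano_space pushforward_affine_action'[OF assms(1)]])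
  ultimately show ?thesis by (simp add: vector_fields_def)
qed

lemma alpha_christoffel_equivariant:
  assumes "a > 0" "p \<in> takano_space"
  shows "alpha_christoffel \<alpha> (affine_action a b p) (affine_linear a u) (affine_linear a v)
    = affine_linear a (alpha_christoffel \<alpha> p u v)"
proof -
  have s: "0 < fst p" using assms by (simp add: takano_space_def)
  show ?thesis
    unfolding alpha_christoffel_def affine_action_def affine_linear_def
    apply (rule prod_eqI)
    subgoal using s assms(1) by (simp add: field_simps power2_eq_square)
    subgoal using s assms(1) by (simp add: vec_eq_iff field_simps power2_eq_square)
    done
qed

text \<open>Affine maps respect the flat derivative, so invariance reduces to the equivariance of the
  Christoffel symbols.\<close>

lemma amari_chentsov_imp_invariant:
  assumes ac: "amari_chentsov_connection \<alpha> (D :: (real \<times> (real^'m)) connection)"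
  shows "invariant_connection takano_space Aff_dplus D"
proof -
  have aff: "affine_connection takano_space D"
    using ac by (auto simp: amari_chentsov_connection_def statistical_structure_def)
  have "D (pushforward takano_space (affine_action a b) X) (pushforward takano_space (affine_action a b) Y) q
      = pushforward takano_space (affine_action a b) (D X Y) q"
    if a: "a > 0" and X: "X \<in> vector_fields takano_space" and Y: "Y \<in> vector_fields takano_space"
      and q: "q \<in> takano_space" for a b X Y q
  proof -
    let ?c = "- inverse a *\<^sub>R b" and ?P = "pushforward takano_space (affine_action a b)"
    define p where "p = affine_action (inverse a) ?c q"
    have p: "p \<in> takano_space" "affine_action a b p = q"
      unfolding p_def affine_action_inverse(2)[OF a] 
      using affine_action_takano_space a q by (metis inverse_positive_iff_positive, simp)
    have Ys: "smooth_on takano_space Y" using Y by (simp add: vector_fields_def)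
    have push: "?P Z q = affine_linear a (Z p)" for Z
      using pushforward_affine_action[OF a p(1), of b Z] p(2) by simp
    have "((\<lambda>q. affine_linear (inverse a) q + (0, ?c)) has_derivative affine_linear (inverse a)) (at q)"
      by (rule has_derivative_add_const[OF bounded_linear_imp_has_derivative[OF bounded_linear_affine_linear]])
    then have "(affine_action (inverse a) ?c has_derivative affine_linear (inverse a)) (at q)"
      by (simp add: affine_action_eq[abs_def])
    from diff_chain_at[OF this smooth_on_has_derivative[OF Ys, of "affine_action (inverse a) ?c q"]]
    have "((\<lambda>q. Y (affine_action (inverse a) ?c q)) has_derivative (\<lambda>h. frechet_derivative Y (at p) (affine_linear (inverse a) h))) (at q)"
      using p(1) by (simp add: o_def p_def)
    from bounded_linear.has_derivative[OF bounded_linear_affine_linear[of a] this]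
    have "(?P Y has_derivative (\<lambda>h. affine_linear a (frechet_derivative Y (at p) (affine_linear (inverse a) h)))) (at q)"
      by (rule has_derivative_transform_within_open[OF _ open_takano_space q])
        (simp add: pushforward_affine_action'[OF a])
    from fun_cong[OF frechet_derivative_at[OF this], of "affine_linear a (X p)"]
    moreover have "affine_linear (inverse a) (affine_linear a v) = v" for v :: "real \<times> (real^'m)"
      using a by (simp add: affine_linear_def prod_eq_iff power_inverse)
    ultimately have "along (?P X) (?P Y) q = affine_linear a (along X Y p)"
      by (simp add: along_def push)
    then have "D (?P X) (?P Y) q = affine_linear a (along X Y p) + affine_linear a (alpha_christoffel \<alpha> p (X p) (Y p))"
      using affine_connection_eq_christoffel[OF open_takano_space aff q pushforward_vector_field[OF a X] pushforward_vector_field[OF a Y]]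
        alpha_christoffel_equivariant[OF a p(1), of \<alpha> b, unfolded p(2)] amari_chentsov_christoffel[OF ac q]
      by (simp add: push)
    also have "\<dots> = affine_linear a (D X Y p)"
      using affine_connection_eq_christoffel[OF open_takano_space aff p(1) X Y] amari_chentsov_christoffel[OF ac p(1)]
      by (simp add: linear_add bounded_linear.linear[OF bounded_linear_affine_linear])
    finally show ?thesis by (simp add: push)
  qed
  then show ?thesis unfolding invariant_connection_def Aff_dplus_def by blast
qed

section \<open>Curvature in an invariant frame\<close>

text \<open>The group acts simply transitively, so a tangent vector at \<open>(1, 0)\<close> extends to an invariant field.
  In these frames the metric and an invariant connection have constant coefficients.\<close>

definition takano_frame :: "real \<times> (real^'m) \<Rightarrow> (real \<times> (real^'m)) field" where
  "takano_frame u p = affine_linear (sqrt (fst p)) u"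

text \<open>The Fisher metric on the frame; as the frame is invariant, this does not depend on the point.\<close>

definition frame_inner :: "real \<times> (real^'m) \<Rightarrow> real \<times> (real^'m) \<Rightarrow> real" where
  "frame_inner u v = real CARD('m) / 2 * (fst u * fst v) + snd u \<bullet> snd v"

definition frame_bracket :: "real \<times> (real^'m) \<Rightarrow> real \<times> (real^'m) \<Rightarrow> real \<times> (real^'m)" where
  "frame_bracket u v = (0, (fst u / 2) *\<^sub>R snd v - (fst v / 2) *\<^sub>R snd u)"

text \<open>The curvature, in the frame, of the connection whose constant coefficients are given by \<open>B\<close>.\<close>

definition frame_curvature ::
    "(real \<times> (real^'m) \<Rightarrow> real \<times> (real^'m) \<Rightarrow> real \<times> (real^'m)) \<Rightarrow>
     real \<times> (real^'m) \<Rightarrow> real \<times> (real^'m) \<Rightarrow> real \<times> (real^'m) \<Rightarrow> real \<times> (real^'m)" where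
  "frame_curvature B u v w = B u (B v w) - B v (B u w) - B (frame_bracket u v) w"

lemma linear_takano_frame: "linear (\<lambda>u. takano_frame u p)"
  unfolding takano_frame_def by (rule bounded_linear.linear[OF bounded_linear_affine_linear])

lemma takano_frame_eq:
  "p \<in> takano_space \<Longrightarrow> takano_frame u p = (fst p * fst u, sqrt (fst p) *\<^sub>R snd u)"
  by (simp add: takano_frame_def affine_linear_def takano_space_def)

lemma takano_frame_vector_field: "takano_frame u \<in> vector_fields takano_space"
proof -
  have "smooth_on takano_space (\<lambda>p. (fst p powr 1) *\<^sub>R (fst u, 0) + (fst p powr (1/2)) *\<^sub>R (0, snd u))"
    by (intro smooth_on_add smooth_on_scaleR smooth_on_const smooth_on_takano_space_powr open_takano_space)
  moreover have "takano_frame u p = (fst p powr 1) *\<^sub>R (fst u, 0) + (fst p powr (1/2)) *\<^sub>R (0, snd u)" 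
    if "p \<in> takano_space" for p
    using that by (simp add: takano_frame_eq powr_half_sqrt takano_space_def)
  ultimately show ?thesis
    using smooth_on_cong[OF open_takano_space, of "takano_frame u"] by (simp add: vector_fields_def)
qed

lemma takano_frame_surj:
  assumes "p \<in> takano_space"
  obtains u where "takano_frame u p = x"
proof
  show "takano_frame (affine_linear (inverse (sqrt (fst p))) x) p = x"
    using assms by (simp add: takano_frame_def affine_linear_def prod_eq_iff power_inverse takano_space_def)
qed

lemma fisher_metric_takano_frame:
  assumes "p \<in> takano_space"
  shows "fisher_metric p (takano_frame u p) (takano_frame v p) = frame_inner u v"
proof -
  have s: "0 < fst p" using assms by (simp add: takano_space_def)
  then have root: "sqrt (fst p) * (sqrt (fst p) * x) = fst p * x" for x
    by (simp add: mult.assoc[symmetric])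
  show ?thesis
    using s by (simp add: root fisher_metric_eq[OF assms] takano_frame_eq[OF assms] frame_inner_def power2_eq_square)
qed

lemma frame_inner_simps:
  "frame_inner u v = frame_inner v u"
  "frame_inner (u + u') v = frame_inner u v + frame_inner u' v"
  "frame_inner (u - u') v = frame_inner u v - frame_inner u' v"
  "frame_inner (r *\<^sub>R u) v = r * frame_inner u v"
  by (simp_all add: frame_inner_def inner_simps algebra_simps add_divide_distrib diff_divide_distrib inner_commute)

lemma frame_inner_eqI:
  assumes "\<And>w. frame_inner x w = frame_inner y w"
  shows "x = (y :: real \<times> (real^'m))"
proof (rule fisher_metric_eqI[of "(1, 0)"])
  show p: "(1, 0) \<in> (takano_space :: (real \<times> (real^'m)) set)" by (simp add: takano_space_def)
  show "fisher_metric (1, 0) x w = fisher_metric (1, 0) y w" for w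
    using assms fisher_metric_takano_frame[OF p] by (simp add: takano_frame_eq[OF p])
qed

lemma lie_bracket_takano_frame:
  assumes "p \<in> takano_space"
  shows "lie_bracket (takano_frame u) (takano_frame v) p = takano_frame (frame_bracket u v) p"
proof -
  have s: "0 < fst p" using assms by (simp add: takano_space_def)
  have d: "frechet_derivative (takano_frame v) (at p) h = (fst h * fst v, (fst h / (2 * sqrt (fst p))) *\<^sub>R snd v)" for v h
  proof -
    have "((\<lambda>q. sqrt (fst q)) has_derivative (\<lambda>h. inverse (sqrt (fst p)) / 2 * fst h)) (at p)"
    proof -
      have "(sqrt has_derivative (\<lambda>t. inverse (sqrt (fst p)) / 2 * t)) (at (fst p))"
        by (rule DERIV_real_sqrt[OF s, unfolded has_field_derivative_def])
      from diff_chain_at[OF has_derivative_fst[OF has_derivative_ident] this]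
      show ?thesis by (simp add: o_def)
    qed
    then have "((\<lambda>q. (fst q * fst v, sqrt (fst q) *\<^sub>R snd v)) has_derivative
        (\<lambda>h. (fst h * fst v, (inverse (sqrt (fst p)) / 2 * fst h) *\<^sub>R snd v))) (at p)"
      by (intro has_derivative_Pair has_derivative_scaleR_left has_derivative_mult_left has_derivative_fst has_derivative_ident)
    then have "(takano_frame v has_derivative
        (\<lambda>h. (fst h * fst v, (inverse (sqrt (fst p)) / 2 * fst h) *\<^sub>R snd v))) (at p)"
      by (rule has_derivative_transform_within_open[OF _ open_takano_space assms]) (simp add: takano_frame_eq)
    from fun_cong[OF frechet_derivative_at[OF this], of h] show ?thesis
      by (simp add: field_simps)
  qed
  have root: "fst p * x / (2 * sqrt (fst p)) = sqrt (fst p) * x / 2" for x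
    using real_div_sqrt[of "fst p"] s by (simp add: field_simps)
  show ?thesis
    by (simp add: d root lie_bracket_def along_def takano_frame_eq[OF assms] frame_bracket_def scaleR_right_diff_distrib)
qed

text \<open>The group element that carries \<open>(1, 0)\<close> to \<open>p\<close> preserves the frame fields, hence carries the covariant
  derivative at \<open>(1, 0)\<close> to the one at \<open>p\<close>.\<close>

lemma invariant_connection_takano_frame:
  fixes D :: "(real \<times> (real^'m)) connection"
  assumes aff: "affine_connection takano_space D" and inv: "invariant_connection takano_space Aff_dplus D"
    and p: "p \<in> takano_space"
  shows "D (takano_frame u) (takano_frame v) p = takano_frame (D (takano_frame u) (takano_frame v) (1, 0)) p"
proof -
  let ?a = "sqrt (fst p)"
  let ?\<phi> = "affine_action ?a (snd p)"
  have a: "?a > 0" using p by (simp add: takano_space_def)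
  have o: "(1, 0) \<in> (takano_space :: (real \<times> (real^'m)) set)" by (simp add: takano_space_def)
  have \<phi>o: "?\<phi> (1, 0) = p" using a by (simp add: affine_action_def)
  have push: "pushforward takano_space ?\<phi> (takano_frame u) q = takano_frame u q" if q: "q \<in> takano_space" for u q
  proof -
    have "sqrt (inverse (fst p) * fst q) = inverse ?a * sqrt (fst q)"
      by (simp add: real_sqrt_mult real_sqrt_inverse)
    then show ?thesis
      using a by (simp add: pushforward_affine_action'[OF a q] takano_frame_def affine_linear_def affine_action_def
          power_mult_distrib power_inverse prod_eq_iff)
  qed
  have "?\<phi> \<in> Aff_dplus" using a by (auto simp: Aff_dplus_def)
  then have "D (pushforward takano_space ?\<phi> (takano_frame u)) (pushforward takano_space ?\<phi> (takano_frame v)) p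
      = pushforward takano_space ?\<phi> (D (takano_frame u) (takano_frame v)) p"
    using inv p takano_frame_vector_field unfolding invariant_connection_def by blast
  also have "\<dots> = takano_frame (D (takano_frame u) (takano_frame v) (1, 0)) p"
    using pushforward_affine_action[OF a o, of "snd p"] \<phi>o by (simp add: takano_frame_def)
  finally show ?thesis
    using affine_connection_local[OF open_takano_space aff p takano_frame_vector_field takano_frame_vector_field push push]
    by simp
qed

lemma curvature_takano_frame:
  assumes aff: "affine_connection takano_space D" and p: "p \<in> takano_space"
    and B: "\<And>q u v. q \<in> takano_space \<Longrightarrow> D (takano_frame u) (takano_frame v) q = takano_frame (B u v) q"
  shows "curvature D (takano_frame u) (takano_frame v) (takano_frame w) p = takano_frame (frame_curvature B u v w) p"
proof -
  note loc = affine_connection_local[OF open_takano_space aff p takano_frame_vector_field takano_frame_vector_field]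
  have "D (takano_frame u) (D (takano_frame v) (takano_frame w)) p = takano_frame (B u (B v w)) p" for u v w
    unfolding B[OF p, symmetric] by (rule loc) (simp_all add: B)
  moreover have "D (lie_bracket (takano_frame u) (takano_frame v)) (takano_frame w) p = takano_frame (B (frame_bracket u v) w) p"
    unfolding B[OF p, symmetric] by (rule loc) (simp_all add: lie_bracket_takano_frame)
  ultimately show ?thesis
    by (simp add: curvature_def frame_curvature_def linear_diff[OF linear_takano_frame])
qed

section \<open>Invariant statistical connections with skew curvature\<close>

text \<open>The Levi-Civita connection of the Fisher metric in the invariant frame.\<close>

definition frame_levi_civita :: "real \<times> (real^'m) \<Rightarrow> real \<times> (real^'m) \<Rightarrow> real \<times> (real^'m)" where
  "frame_levi_civita u v = ((snd u \<bullet> snd v) / real CARD('m), - (fst v / 2) *\<^sub>R snd u)"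

lemma frame_levi_civita_metric:
  "frame_inner (frame_levi_civita u v) w = - frame_inner v (frame_levi_civita u w)"
  by (simp add: frame_inner_def frame_levi_civita_def inner_commute)

lemma frame_levi_civita_torsion_free:
  "frame_levi_civita u v - frame_levi_civita v u = frame_bracket u v"
  by (simp add: frame_levi_civita_def frame_bracket_def inner_commute)

lemma bilinear_frame_levi_civita: "bilinear frame_levi_civita"
  by (auto simp: bilinear_def frame_levi_civita_def inner_simps algebra_simps add_divide_distrib intro!: linearI)

text \<open>Write \<open>B = L + K\<close> with the Levi-Civita part \<open>L\<close>, so that \<open>S(u, v, w) = \<langle>K(u, v), w\<rangle>\<close> is totally symmetric.
  In the symmetric part of the curvature the terms quadratic in \<open>K\<close> cancel, because each \<open>K(u, _)\<close> is
  self-adjoint, and so does the curvature of \<open>L\<close>. What remains is the covariant derivative of \<open>K\<close>;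
  along the variance direction, where \<open>L\<close> vanishes, its vanishing expresses \<open>S\<close> on mean directions
  through \<open>S\<close> with one variance argument, and leaves a single free parameter.\<close>

lemma skew_curvature_cubic_form:
  fixes B :: "real \<times> (real^'m) \<Rightarrow> real \<times> (real^'m) \<Rightarrow> real \<times> (real^'m)"
  assumes bil: "bilinear B"
    and tor: "\<And>u v. B u v - B v u = frame_bracket u v"
    and cub: "\<And>u v w. frame_inner (B u v) w + frame_inner v (B u w) = frame_inner (B v u) w + frame_inner u (B v w)"
    and skew: "\<And>u v w z. frame_inner (frame_curvature B u v w) z + frame_inner w (frame_curvature B u v z) = 0"
  shows "\<exists>\<alpha>. \<forall>u v w. - frame_inner (B u v) w - frame_inner v (B u w) =
     \<alpha> * (real CARD('m) * (fst u * fst v * fst w)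
      + (fst u * (snd v \<bullet> snd w) + fst v * (snd u \<bullet> snd w) + fst w * (snd u \<bullet> snd v)))"
proof -
  let ?I = frame_inner and ?L = "frame_levi_civita :: real \<times> (real^'m) \<Rightarrow> _"
  let ?e = "(1, 0) :: real \<times> (real^'m)" and ?j = "\<lambda>a::real^'m. (0::real, a)"
  note I = frame_inner_simps(2-4)
  have Ic: "?I u v = ?I v u" for u v :: "real \<times> (real^'m)" by (rule frame_inner_simps(1))
  define S where "S u v w = ?I (B u v) w - ?I (?L u v) w" for u v w
  have IB: "?I (B u v) w = S u v w + ?I (?L u v) w" for u v w by (simp add: S_def)
  have S12: "S u v w = S v u w" for u v w
  proof -
    have "B u v - B v u = ?L u v - ?L v u" by (simp add: tor frame_levi_civita_torsion_free)
    then have "?I (B u v - B v u) w = ?I (?L u v - ?L v u) w" by simp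
    then show ?thesis by (simp add: I S_def)
  qed
  have SS: "?I (B u v) w + ?I v (B u w) = S u v w + S u w v" for u v w
    using frame_levi_civita_metric[of u v w] Ic[of v "B u w"] Ic[of v "?L u w"] by (simp add: S_def)
  have S23: "S w u v = S w v u" for u v w
    using cub[of u v w] SS[of u v w] SS[of v u w] S12 by (metis add_left_cancel)
  have Sadd: "S (u + u') v w = S u v w + S u' v w" and Sscale: "S (r *\<^sub>R u) v w = r * S u v w" for u u' v w r
    by (simp_all add: S_def bilinear_ladd[OF bil] bilinear_lmul[OF bil] I algebra_simps
        bilinear_ladd[OF bilinear_frame_levi_civita] bilinear_lmul[OF bilinear_frame_levi_civita])
  have Le: "?L ?e x = 0" for x by (simp add: frame_levi_civita_def prod_eq_iff)
  have I0: "?I 0 x = 0" for x :: "real \<times> (real^'m)" by (simp add: frame_inner_def)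
  have IBe: "?I (B ?e x) z = S ?e x z" for x z by (simp add: IB Le I0)
  have key: "S (?j a) w z = 2 * S ?e z (?L (?j a) w) + 2 * S ?e w (?L (?j a) z)" for a w z
  proof -
    let ?v = "?j a"
    have br: "frame_bracket ?e ?v = (1/2) *\<^sub>R ?v" by (simp add: frame_bracket_def)
    \<comment> \<open>symmetrizing in \<open>w\<close> and \<open>z\<close> cancels the two terms that are quadratic in \<open>B\<close>\<close>
    have R: "?I (frame_curvature B ?e ?v w) z =
        S ?v w (B ?e z) + S ?e z (?L ?v w) - S ?v z (B ?e w) + S ?e w (?L ?v z) - ?I (B ?v w) z / 2" for w z
    proof -
      have "?I (B ?e (B ?v w)) z = ?I (B ?v w) (B ?e z)"
        by (metis IBe S23 Ic)
      also have "\<dots> = S ?v w (B ?e z) + S ?e z (?L ?v w)" 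
        by (metis IB IBe Ic)
      finally have 1: "?I (B ?e (B ?v w)) z = S ?v w (B ?e z) + S ?e z (?L ?v w)" .
      have "?I (B ?v (B ?e w)) z = S ?v (B ?e w) z - ?I (B ?e w) (?L ?v z)"
        by (simp add: IB[of ?v] frame_levi_civita_metric)
      also have "\<dots> = S ?v z (B ?e w) - S ?e w (?L ?v z)"
        by (simp add: IBe S23[of ?v z])
      finally have 2: "?I (B ?v (B ?e w)) z = S ?v z (B ?e w) - S ?e w (?L ?v z)" .
      show ?thesis
        by (simp add: frame_curvature_def br I bilinear_lmul[OF bil] 1 2 del: scaleR_Pair)
    qed
    have "?I (B ?v w) z + ?I (B ?v z) w = 2 * S ?v w z"
      using SS[of ?v w z] Ic[of w "B ?v z"] S23[of ?v w z] by simp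
    then show ?thesis
      using skew[of ?e ?v w z] Ic[of w "frame_curvature B ?e ?v z"] R[of w z] R[of z w] by (simp add: field_simps)
  qed
  define \<kappa> where "\<kappa> = S ?e ?e ?e"
  define m where "m = real CARD('m)"
  have m: "m > 0" by (simp add: m_def)
  have Lj: "?L (?j a) ?e = (- 1 / 2) *\<^sub>R ?j a" "?L (?j a) (?j b) = ((a \<bullet> b) / m) *\<^sub>R ?e" for a b
    by (simp_all add: frame_levi_civita_def m_def)
  have Sscale3: "S u v (r *\<^sub>R w) = r * S u v w" for u v w r
    by (metis S12 S23 Sscale)
  have S1: "S (?j a) ?e ?e = 0" for a
  proof -
    have "S (?j a) ?e ?e = - 2 * S ?e ?e (?j a)"
      using key[of a ?e ?e] by (simp only: Lj Sscale3)
    moreover have "S ?e ?e (?j a) = S (?j a) ?e ?e" using S12 S23 by metis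
    ultimately show ?thesis by simp
  qed
  have S2: "S ?e (?j a) (?j b) = (a \<bullet> b) / m * \<kappa>" for a b
  proof -
    have "S (?j a) ?e (?j b) = - S ?e (?j b) (?j a) + 2 * ((a \<bullet> b) / m * \<kappa>)"
      using key[of a ?e "?j b"] by (simp only: Lj Sscale3 \<kappa>_def)
    moreover have "S (?j a) ?e (?j b) = S ?e (?j a) (?j b)" "S ?e (?j b) (?j a) = S ?e (?j a) (?j b)"
      using S12 S23 by metis+
    ultimately show ?thesis by simp
  qed
  have S3: "S (?j a) (?j b) (?j c) = 0" for a b c
  proof -
    have "S ?e (?j x) ?e = 0" for x using S1 S12 by metis
    then show ?thesis using key[of a "?j b" "?j c"] by (simp only: Lj Sscale3)
  qed
  have split: "u = fst u *\<^sub>R ?e + ?j (snd u)" for u :: "real \<times> (real^'m)" by (simp add: prod_eq_iff)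
  have Sx: "S u v w = fst u * S ?e v w + S (?j (snd u)) v w" for u v w
    by (subst split[of u]) (simp only: Sadd Sscale)
  have Sy: "S u v w = fst v * S u ?e w + S u (?j (snd v)) w" for u v w
    by (metis Sx S12)
  have Sz: "S u v w = fst w * S u v ?e + S u v (?j (snd w))" for u v w
    by (metis Sy S23)
  have S: "m * S u v w = \<kappa> * (m * (fst u * fst v * fst w)
      + (fst u * (snd v \<bullet> snd w) + fst v * (snd u \<bullet> snd w) + fst w * (snd u \<bullet> snd v)))" for u v w
  proof -
    have z: "S ?e ?e (?j a) = 0" "S ?e (?j a) ?e = 0" "S (?j a) ?e ?e = 0" for a
      using S1 S12 S23 by metis+
    have y: "S (?j a) (?j b) ?e = (a \<bullet> b) / m * \<kappa>" "S (?j a) ?e (?j b) = (a \<bullet> b) / m * \<kappa>" for a b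
      using S2 S12 S23 by metis+
    have "S u v w = fst u * (fst v * (fst w * \<kappa>) + (snd v \<bullet> snd w) / m * \<kappa>)
        + (fst v * ((snd u \<bullet> snd w) / m * \<kappa>) + fst w * ((snd u \<bullet> snd v) / m * \<kappa>))"
      using Sx[of u v w] Sy[of ?e v w] Sy[of "?j (snd u)" v w] Sz[of ?e ?e w] Sz[of ?e "?j (snd v)" w]
        Sz[of "?j (snd u)" ?e w] Sz[of "?j (snd u)" "?j (snd v)" w]
      by (simp add: z y S2 S3 \<kappa>_def)
    then show ?thesis using m by (simp only:) (simp add: field_simps)
  qed
  show ?thesis
  proof (intro exI[of _ "- 2 * \<kappa> / m"] allI)
    fix u v w
    have "- frame_inner (B u v) w - frame_inner v (B u w) = - 2 * (m * S u v w) / m"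
      using SS[of u v w] S23[of u v w] m by simp
    also have "\<dots> = - 2 * \<kappa> / m * (m * (fst u * fst v * fst w)
      + (fst u * (snd v \<bullet> snd w) + fst v * (snd u \<bullet> snd w) + fst w * (snd u \<bullet> snd v)))"
      unfolding S by simp
    finally show "- frame_inner (B u v) w - frame_inner v (B u w) = - 2 * \<kappa> / m * (real CARD('m) * (fst u * fst v * fst w)
      + (fst u * (snd v \<bullet> snd w) + fst v * (snd u \<bullet> snd w) + fst w * (snd u \<bullet> snd v)))"
      by (simp only: m_def)
  qed
qed

lemma covariant_derivative_metric_takano_frame:
  assumes p: "p \<in> takano_space"
    and B: "\<And>q u v. q \<in> takano_space \<Longrightarrow> D (takano_frame u) (takano_frame v) q = takano_frame (B u v) q"
  shows "covariant_derivative_metric fisher_metric D (takano_frame u) (takano_frame v) (takano_frame w) p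
    = - frame_inner (B u v) w - frame_inner v (B u w)"
proof -
  have "frechet_derivative (\<lambda>q. fisher_metric q (takano_frame v q) (takano_frame w q)) (at p)
      = frechet_derivative (\<lambda>q. frame_inner v w) (at p)"
    by (rule frechet_derivative_cong_open[OF open_takano_space p fisher_metric_takano_frame])
  then show ?thesis
    by (simp add: covariant_derivative_metric_def along_def B[OF p] fisher_metric_takano_frame[OF p])
qed

text \<open>A cubic form is tensorial, so it suffices to compare it with the Amari-Chentsov tensor on the frame.\<close>

lemma invariant_skew_curvature_imp_amari_chentsov:
  fixes D :: "(real \<times> (real^'m)) connection"
  assumes stat: "statistical_structure takano_space fisher_metric D"
    and inv: "invariant_connection takano_space Aff_dplus D"
    and skew: "\<And>u v w z. fisher_metric (1, 0) (curvature D (takano_frame u) (takano_frame v) (takano_frame w) (1, 0)) (takano_frame z (1, 0))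
      + fisher_metric (1, 0) (takano_frame w (1, 0)) (curvature D (takano_frame u) (takano_frame v) (takano_frame z) (1, 0)) = 0"
  shows "\<exists>\<alpha>. amari_chentsov_connection \<alpha> D"
proof -
  let ?M = "takano_space :: (real \<times> (real^'m)) set"
  have aff: "affine_connection ?M D" and tf: "torsion_free ?M D" and g: "riemannian_metric ?M fisher_metric"
    using stat by (auto simp: statistical_structure_def)
  have o: "(1, 0) \<in> ?M" by (simp add: takano_space_def)
  have fo: "takano_frame u (1, 0) = u" for u :: "real \<times> (real^'m)"
    by (simp add: takano_frame_eq[OF o])
  note E = takano_frame_vector_field
  define B where "B u v = D (takano_frame u) (takano_frame v) (1, 0)" for u v
  have B: "D (takano_frame u) (takano_frame v) q = takano_frame (B u v) q" if "q \<in> ?M" for q u v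
    unfolding B_def by (rule invariant_connection_takano_frame[OF aff inv that])
  have lin: "takano_frame (u + v) = (\<lambda>q. takano_frame u q + takano_frame v q)"
    "takano_frame (r *\<^sub>R u) = (\<lambda>q. r *\<^sub>R takano_frame u q)" for u v :: "real \<times> (real^'m)" and r
    by (simp_all add: fun_eq_iff linear_add[OF linear_takano_frame] linear_scale[OF linear_takano_frame])
  note rules = affine_connection_add_left affine_connection_scale_left affine_connection_add_right affine_connection_leibniz
  note rules = rules[OF open_takano_space aff E E o]
  have "B (u + u') v = B u v + B u' v" "B (r *\<^sub>R u) v = r *\<^sub>R B u v"
    "B u (v + v') = B u v + B u v'" "B u (r *\<^sub>R v) = r *\<^sub>R B u v" for u u' v v' r
    unfolding B_def lin using rules(1,3)[OF E] rules(2,4)[OF smooth_on_const] by simp_all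
  then have bil: "bilinear B"
    unfolding bilinear_def linear_iff by blast
  have tor: "B u v - B v u = frame_bracket u v" for u v
    using tf E o lie_bracket_takano_frame[OF o, of u v] unfolding torsion_free_def B_def fo by metis
  have C: "covariant_derivative_metric fisher_metric D (takano_frame u) (takano_frame v) (takano_frame w) p
    = - frame_inner (B u v) w - frame_inner v (B u w)" if "p \<in> ?M" for p u v w
    by (rule covariant_derivative_metric_takano_frame[where D = D and B = B, OF that B])
  have cub: "frame_inner (B u v) w + frame_inner v (B u w) = frame_inner (B v u) w + frame_inner u (B v w)" for u v w
  proof -
    have "covariant_derivative_metric fisher_metric D (takano_frame u) (takano_frame v) (takano_frame w) (1, 0)
      = covariant_derivative_metric fisher_metric D (takano_frame v) (takano_frame u) (takano_frame w) (1, 0)"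
      using stat o E unfolding statistical_structure_def by blast
    then show ?thesis by (simp add: C[OF o])
  qed
  have "frame_inner (frame_curvature B u v w) z + frame_inner w (frame_curvature B u v z) = 0" for u v w z
    using skew[of u v w z] by (simp add: curvature_takano_frame[where B = B, OF aff o B] fisher_metric_takano_frame[OF o])
  from skew_curvature_cubic_form[OF bil tor cub this] obtain \<alpha> where \<alpha>:
    "\<And>u v w. - frame_inner (B u v) w - frame_inner v (B u w) =
     \<alpha> * (real CARD('m) * (fst u * fst v * fst w)
      + (fst u * (snd v \<bullet> snd w) + fst v * (snd u \<bullet> snd w) + fst w * (snd u \<bullet> snd v)))" by blast
  have "covariant_derivative_metric fisher_metric D X Y Z p = amari_chentsov_tensor \<alpha> p (X p) (Y p) (Z p)"
    if X: "X \<in> vector_fields ?M" and Y: "Y \<in> vector_fields ?M" and Z: "Z \<in> vector_fields ?M" and p: "p \<in> ?M" for X Y Z p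
  proof -
    have s: "0 < fst p" using p by (simp add: takano_space_def)
    then have root: "sqrt (fst p) * (sqrt (fst p) * x) = fst p * x" for x
      by (simp add: mult.assoc[symmetric])
    obtain u v w where uvw: "takano_frame u p = X p" "takano_frame v p = Y p" "takano_frame w p = Z p"
      using takano_frame_surj[OF p] by metis
    note tensorial = covariant_derivative_metric_eq_christoffel[OF open_takano_space aff g p]
    have "covariant_derivative_metric fisher_metric D X Y Z p
      = covariant_derivative_metric fisher_metric D (takano_frame u) (takano_frame v) (takano_frame w) p"
      unfolding tensorial[OF X Y Z] tensorial[OF E E E] uvw ..
    also have "\<dots> = amari_chentsov_tensor \<alpha> p (takano_frame u p) (takano_frame v p) (takano_frame w p)"
      unfolding C[OF p] \<alpha> amari_chentsov_tensor_eq[OF p] takano_frame_eq[OF p]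
      using s by (simp add: root field_simps power2_eq_square power3_eq_cube)
    finally show ?thesis unfolding uvw .
  qed
  then show ?thesis using stat unfolding amari_chentsov_connection_def by blast
qed

lemma constant_curvature_imp_skew:
  assumes "constant_curvature M g D" "riemannian_metric M g" "p \<in> M"
    and XYZW: "X \<in> vector_fields M" "Y \<in> vector_fields M" "Z \<in> vector_fields M" "W \<in> vector_fields M"
  shows "g p (curvature D X Y Z p) (W p) + g p (Z p) (curvature D X Y W p) = 0"
proof -
  obtain k where k: "\<And>X Y Z. X \<in> vector_fields M \<Longrightarrow> Y \<in> vector_fields M \<Longrightarrow> Z \<in> vector_fields M \<Longrightarrow>
      curvature D X Y Z p = k *\<^sub>R (g p (Y p) (Z p) *\<^sub>R X p - g p (X p) (Z p) *\<^sub>R Y p)"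
    using assms unfolding constant_curvature_def by blast
  have bil: "bilinear (g p)" and sym: "g p u v = g p v u" for u v
    using assms(2,3) by (auto simp: riemannian_metric_def)
  show ?thesis
    using sym[of "Z p" "X p"] sym[of "Z p" "Y p"]
    by (simp add: k XYZW bilinear_lmul[OF bil] bilinear_rmul[OF bil] bilinear_lsub[OF bil] bilinear_rsub[OF bil] algebra_simps)
qed

text \<open>In the frame the coefficients of the dual connection are the negative adjoints of those of \<open>D\<close>, hence
  so is its curvature: equality of the two curvatures means that the curvature is skew.\<close>

lemma conjugate_symmetric_imp_skew:
  fixes D :: "(real \<times> (real^'m)) connection"
  assumes aff: "affine_connection takano_space D" and inv: "invariant_connection takano_space Aff_dplus D"
    and conj: "conjugate_symmetric takano_space fisher_metric D"
  shows "fisher_metric (1, 0) (curvature D (takano_frame u) (takano_frame v) (takano_frame w) (1, 0)) (takano_frame z (1, 0))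
      + fisher_metric (1, 0) (takano_frame w (1, 0)) (curvature D (takano_frame u) (takano_frame v) (takano_frame z) (1, 0)) = 0"
proof -
  let ?M = "takano_space :: (real \<times> (real^'m)) set"
  have o: "(1, 0) \<in> ?M" by (simp add: takano_space_def)
  note E = takano_frame_vector_field
  define B where "B u v = D (takano_frame u) (takano_frame v) (1, 0)" for u v
  have B: "D (takano_frame u) (takano_frame v) q = takano_frame (B u v) q" if "q \<in> ?M" for q u v
    unfolding B_def by (rule invariant_connection_takano_frame[OF aff inv that])
  obtain D' where dual: "dual_connection ?M fisher_metric D D'"
    and eq: "\<And>X Y Z p. X \<in> vector_fields ?M \<Longrightarrow> Y \<in> vector_fields ?M \<Longrightarrow> Z \<in> vector_fields ?M \<Longrightarrow> p \<in> ?M \<Longrightarrow>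
      curvature D X Y Z p = curvature D' X Y Z p"
    using conj unfolding conjugate_symmetric_def by blast
  have aff': "affine_connection ?M D'" using dual by (simp add: dual_connection_def)
  define B' where "B' u v = D' (takano_frame u) (takano_frame v) (1, 0)" for u v
  have adj: "frame_inner (B u v) w + frame_inner v b = 0"
    if q: "q \<in> ?M" and b: "D' (takano_frame u) (takano_frame w) q = takano_frame b q" for q u v w b
  proof -
    have "along (takano_frame u) (\<lambda>q. fisher_metric q (takano_frame v q) (takano_frame w q)) q
        = fisher_metric q (takano_frame (B u v) q) (takano_frame w q) + fisher_metric q (takano_frame v q) (takano_frame b q)"
      using dual q E unfolding dual_connection_def B[OF q, symmetric] b[symmetric] by blast
    moreover have "frechet_derivative (\<lambda>q. fisher_metric q (takano_frame v q) (takano_frame w q)) (at q)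
      = frechet_derivative (\<lambda>q. frame_inner v w) (at q)"
      by (rule frechet_derivative_cong_open[OF open_takano_space q fisher_metric_takano_frame])
    ultimately show ?thesis by (simp add: along_def fisher_metric_takano_frame[OF q])
  qed
  have o': "takano_frame u (1, 0) = u" for u :: "real \<times> (real^'m)"
    by (simp add: takano_frame_eq[OF o])
  have adj': "frame_inner (B u v) w = - frame_inner v (B' u w)" for u v w
    using adj[OF o, of u w "B' u w" v] by (simp add: B'_def o')
  have B': "D' (takano_frame u) (takano_frame w) q = takano_frame (B' u w) q" if q: "q \<in> ?M" for q u w
  proof -
    \<comment> \<open>duality determines \<open>b\<close> at every \<open>q\<close>, so it agrees with the coefficient at \<open>(1, 0)\<close>\<close>
    obtain b where b: "takano_frame b q = D' (takano_frame u) (takano_frame w) q"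
      using takano_frame_surj[OF q] by metis
    have "frame_inner b v = frame_inner (B' u w) v" for v
      using adj[OF q b[symmetric], of v] adj'[of u v w] frame_inner_simps(1)[of v] by simp
    then have "b = B' u w" by (rule frame_inner_eqI)
    then show ?thesis using b by simp
  qed
  have "frame_inner w (frame_curvature B' u v z) = - frame_inner (frame_curvature B u v w) z"
  proof -
    have sub: "frame_inner w (x - y) = frame_inner w x - frame_inner w y" for w x y :: "real \<times> (real^'m)"
      by (metis frame_inner_simps(1,3))
    have "frame_inner w (B' a x) = - frame_inner (B a w) x" for a w x by (simp add: adj')
    then show ?thesis by (simp add: frame_curvature_def sub frame_inner_simps(3) adj')
  qed
  moreover have "curvature D (takano_frame u) (takano_frame v) (takano_frame z) (1, 0) = takano_frame (frame_curvature B' u v z) (1, 0)"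
    unfolding eq[OF E E E o] by (rule curvature_takano_frame[where B = B', OF aff' o B'])
  ultimately show ?thesis
    by (simp add: curvature_takano_frame[where B = B, OF aff o B] fisher_metric_takano_frame[OF o])
qed

theorem theorem6p8:
  fixes nabla :: "(real \<times> (real^'m)) connection"
  assumes "statistical_structure takano_space fisher_metric nabla"
  shows "((invariant_connection takano_space Aff_dplus nabla \<and>
            conjugate_symmetric takano_space fisher_metric nabla)
          \<longleftrightarrow>
          (invariant_connection takano_space Aff_dplus nabla \<and>
            constant_curvature takano_space fisher_metric nabla))
       \<and> ((invariant_connection takano_space Aff_dplus nabla \<and>
            constant_curvature takano_space fisher_metric nabla)
          \<longleftrightarrow>
          (\<exists>\<alpha>::real. amari_chentsov_connection \<alpha> nabla))"
proof -
  let ?M = "takano_space :: (real \<times> (real^'m)) set"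
  have g: "riemannian_metric ?M fisher_metric" and aff: "affine_connection ?M nabla"
    using assms by (auto simp: statistical_structure_def)
  have o: "(1, 0) \<in> ?M" by (simp add: takano_space_def)
  have "\<exists>\<alpha>. amari_chentsov_connection \<alpha> nabla"
    if "invariant_connection ?M Aff_dplus nabla" "conjugate_symmetric ?M fisher_metric nabla"
    by (rule invariant_skew_curvature_imp_amari_chentsov[OF assms that(1) conjugate_symmetric_imp_skew[OF aff that]])
  moreover have "\<exists>\<alpha>. amari_chentsov_connection \<alpha> nabla"
    if "invariant_connection ?M Aff_dplus nabla" "constant_curvature ?M fisher_metric nabla"
    by (rule invariant_skew_curvature_imp_amari_chentsov[OF assms that(1)])
      (intro constant_curvature_imp_skew[OF that(2) g o] takano_frame_vector_field)
  ultimately show ?thesis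
    using amari_chentsov_imp_invariant amari_chentsov_imp_conjugate_symmetric
      amari_chentsov_imp_constant_curvature by blast
qed

end
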